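(* Let $(\Omega,\mathcal F,\mathbb P)$ be a probability space and let $\rho,a:\mathbb R\times\Omega\to\mathbb R$ be $\mathcal B(\mathbb R)\times\mathcal F$-measurable such that for $\mathbb P$-a.e. $W$ the functions $a(\cdot,W)$ and $\rho(\cdot,W)$ are continuous and $\int_0^\infty e^{-a(z,W)}\,dz=\int_{-\infty}^0 e^{-a(z,W)}\,dz=+\infty$. Then for each $\theta\in(0,1)$ there exist deterministic constants $C=C(\theta)>0$ and $N=N(\theta)>0$ such that for $\mathbb P$-a.e. $W$ one has, for all $0<t<1$, $r>0$ and $x\in\mathbb R$, $$P_x^W\big(\tau_{D_W(x,r)}\le t\big)\le C\,t^{-N}\exp\big(C\,M(D_W(x,r))\big)\exp\Big\{-a_\theta\frac{r^2}{t}\Big\},\qquad a_\theta=\frac{(1-\theta)^2}{2(1+\theta)}.$$ In particular $a_\theta\uparrow1/2$ as $\theta\downarrow0$.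
   Context: Quenched diffusion. For fixed $W$ put $S_W(x)=\int_0^xe^{-a(z,W)}\,dz$ and $\sigma(q)=\sqrt2\exp\big(-\tfrac12[\rho(S_W^{-1}(q),W)+a(S_W^{-1}(q),W)]\big)$. Let $B$ be a one-dimensional Brownian motion started from $S_W(x)$, independent of the environment, and $\phi(t)=\int_0^t\sigma(B(s))^{-2}\,ds$. The quenched diffusion started from $x$ is $X^W(t)=S_W^{-1}(B(\phi^{-1}(t)))$, $t\ge0$; its law is $P_x^W$. (Its generator is $\mathcal L_Wf=e^{-\rho(\cdot,W)}(e^{a(\cdot,W)}f')'$.) Intrinsic distance: $d_W(x,y)=\left|\int_x^y\sqrt{\tfrac12e^{\rho(z,W)-a(z,W)}}\,dz\right|$, and $D_W(x,r)=\{y\in\mathbb R:d_W(x,y)<r\}$. For an open set $D$, $\tau_D=\inf\{s\ge0:X^W_s\notin D\}$. For $K\subset\mathbb R$, $M(K)=\sup_{x\in K}|\rho(x,W)|+\sup_{x\in K}|a(x,W)|\in[0,\infty]$ (if $M=\infty$ the right-hand side is $+\infty$). *)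

theory Defs
  imports "HOL-Probability.Probability"
begin

text \<open>
  Throughout, \<open>\<rho>\<close> and \<open>a\<close> denote the coefficient functions of one fixed environment \<open>W\<close>, i.e.
  \<open>\<lambda>z. \<rho> z W\<close> and \<open>\<lambda>z. a z W\<close>; \<open>LBINT\<close> is the oriented Lebesgue interval integral.
\<close>

definition scale_fun :: "(real \<Rightarrow> real) \<Rightarrow> real \<Rightarrow> real" where
  "scale_fun a x = (LBINT z=0..ereal x. exp (- a z))"

definition diff_coeff :: "(real \<Rightarrow> real) \<Rightarrow> (real \<Rightarrow> real) \<Rightarrow> real \<Rightarrow> real" where
  "diff_coeff \<rho> a q =
     sqrt 2 * exp (- (1/2) * (\<rho> (inv (scale_fun a) q) + a (inv (scale_fun a) q)))"

locale brownian_motion = prob_space Q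
  for Q :: "'b measure" and B :: "real \<Rightarrow> 'b \<Rightarrow> real" and q :: real +
  assumes measurable_B: "\<And>t. 0 \<le> t \<Longrightarrow> B t \<in> borel_measurable Q"
    and start_B: "\<And>\<omega>. \<omega> \<in> space Q \<Longrightarrow> B 0 \<omega> = q"
    and continuous_B: "\<And>\<omega>. \<omega> \<in> space Q \<Longrightarrow> continuous_on {0..} (\<lambda>t. B t \<omega>)"
    and normal_increments: "\<And>s t. 0 \<le> s \<Longrightarrow> s < t \<Longrightarrow>
          distributed Q lborel (\<lambda>\<omega>. B t \<omega> - B s \<omega>) (normal_density 0 (sqrt (t - s)))"
    and indep_increments: "\<And>u :: nat \<Rightarrow> real. 0 \<le> u 0 \<Longrightarrow> incseq u \<Longrightarrow>
          indep_vars (\<lambda>_. borel) (\<lambda>i \<omega>. B (u (Suc i)) \<omega> - B (u i) \<omega>) UNIV"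

definition clock :: "(real \<Rightarrow> real) \<Rightarrow> (real \<Rightarrow> real) \<Rightarrow> (real \<Rightarrow> real) \<Rightarrow> real \<Rightarrow> real" where
  "clock \<rho> a b t = (LBINT s=0..ereal t. inverse ((diff_coeff \<rho> a (b s))\<^sup>2))"

text \<open>
  For a Brownian path \<open>b\<close> the clock almost surely maps \<open>{0..}\<close> bijectively onto itself. On the
  exceptional null set, times outside its range get the value \<open>0\<close>; thereby the diffusion below
  never evaluates \<open>b\<close> at a negative time, and the events \<open>{\<tau>\<^sub>D \<le> t}\<close> remain measurable without
  completing the underlying probability space.
\<close>

definition clock_inv :: "(real \<Rightarrow> real) \<Rightarrow> (real \<Rightarrow> real) \<Rightarrow> (real \<Rightarrow> real) \<Rightarrow> real \<Rightarrow> real" where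
  "clock_inv \<rho> a b t =
     (if t \<in> clock \<rho> a b ` {0..} then inv_into {0..} (clock \<rho> a b) t else 0)"

definition diffusion :: "(real \<Rightarrow> real) \<Rightarrow> (real \<Rightarrow> real) \<Rightarrow> (real \<Rightarrow> real) \<Rightarrow> real \<Rightarrow> real" where
  "diffusion \<rho> a b t = inv (scale_fun a) (b (clock_inv \<rho> a b t))"

definition intr_dist :: "(real \<Rightarrow> real) \<Rightarrow> (real \<Rightarrow> real) \<Rightarrow> real \<Rightarrow> real \<Rightarrow> real" where
  "intr_dist \<rho> a x y = \<bar>LBINT z=ereal x..ereal y. sqrt (1/2 * exp (\<rho> z - a z))\<bar>"

definition intr_ball :: "(real \<Rightarrow> real) \<Rightarrow> (real \<Rightarrow> real) \<Rightarrow> real \<Rightarrow> real \<Rightarrow> real set" where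
  "intr_ball \<rho> a x r = {y. intr_dist \<rho> a x y < r}"

definition exit_time :: "real set \<Rightarrow> (real \<Rightarrow> real) \<Rightarrow> ereal" where
  "exit_time D X = Inf (ereal ` {s. 0 \<le> s \<and> X s \<notin> D})"

definition coeff_bound :: "(real \<Rightarrow> real) \<Rightarrow> (real \<Rightarrow> real) \<Rightarrow> real set \<Rightarrow> ennreal" where
  "coeff_bound \<rho> a K = (SUP x\<in>K. ennreal \<bar>\<rho> x\<bar>) + (SUP x\<in>K. ennreal \<bar>a x\<bar>)"

definition exp_ennreal :: "ennreal \<Rightarrow> ennreal" where
  "exp_ennreal u = (if u = \<infinity> then \<infinity> else ennreal (exp (enn2real u)))"

definition a_coeff :: "real \<Rightarrow> real" where
  "a_coeff \<theta> = (1 - \<theta>)\<^sup>2 / (2 * (1 + \<theta>))"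

locale random_environment = prob_space M
  for M :: "'w measure" and \<rho> a :: "real \<Rightarrow> 'w \<Rightarrow> real" +
  assumes measurable_rho: "(\<lambda>(z, W). \<rho> z W) \<in> borel_measurable (borel \<Otimes>\<^sub>M M)"
    and measurable_a: "(\<lambda>(z, W). a z W) \<in> borel_measurable (borel \<Otimes>\<^sub>M M)"
    and continuous_env: "AE W in M. continuous_on UNIV (\<lambda>z. a z W) \<and> continuous_on UNIV (\<lambda>z. \<rho> z W)"
    and scale_infinite: "AE W in M.
          (\<integral>\<^sup>+z\<in>{0..}. ennreal (exp (- a z W)) \<partial>lborel) = \<infinity> \<and>
          (\<integral>\<^sup>+z\<in>{..0}. ennreal (exp (- a z W)) \<partial>lborel) = \<infinity>"

end

theory Submission
  imports Defs
begin

text \<open>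
  In the natural scale the diffusion is a Brownian motion \<open>B\<close> run with the clock
  \<open>\<integral> V (B s) / 2 ds\<close>, where \<open>V = exp (\<rho> + a) \<circ> S\<inverse>\<close>. For \<open>\<eta> > 0\<close> let \<open>f\<close> solve \<open>f'' = \<eta> V f\<close> with
  \<open>f = 1\<close> and \<open>f' = 0\<close> at the starting point. Then \<open>exp (- \<eta> clock) f (B)\<close> is a martingale and a
  Chernoff bound gives \<open>P (\<tau> \<le> t) \<le> exp (\<eta> t) / min f\<close>, the minimum being over the two end points of
  the interval. The growth of \<open>f\<close> comes from
  \<open>(f f')' = f'\<^sup>2 + \<eta> V f\<^sup>2 \<ge> 2 sqrt (\<eta> V) f f'\<close>: the integral of \<open>sqrt (\<eta> V)\<close> in the natural scale is
  \<open>sqrt (2 \<eta>)\<close> times the intrinsic distance, so \<open>f \<ge> exp (sqrt (2 \<eta>) r - 1 - M)\<close> at the boundary, no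
  regularity of the coefficients being needed. The choice \<open>\<eta> = r\<^sup>2 / (2 t\<^sup>2)\<close> yields
  \<open>exp (1 + M - r\<^sup>2 / (2 t))\<close>, and \<open>a_coeff \<theta> \<le> 1/2\<close>.

  Stochastic calculus is avoided by sampling \<open>B\<close> on a grid of mesh \<open>h\<close>. As \<open>f \<ge> 1\<close> and \<open>V\<close> is bounded
  below, a Gaussian step multiplies the mean of \<open>f\<close> by at most \<open>exp (\<theta> h \<eta> V / 2)\<close> for any \<open>\<theta> > 1\<close> and
  small \<open>h\<close>; hence the sampled process, frozen after its exit, is an exact supermartingale for a
  slightly faster clock. Continuity of the paths puts the exit event inside the lower limit of the
  sampled exit events, which are measurable.
\<close>

section \<open>The eigenvalue equation on an interval\<close>

text \<open>\<open>g\<close> is nondecreasing and vanishes at \<open>x\<close>, so it has the sign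
  of \<open>y - x\<close>. The disjunction \<open>uv\<close> says that \<open>v\<close> lies beyond
  \<open>u\<close> as seen from \<open>x\<close>, so that one statement serves both sides.\<close>

lemma second_deriv_nonneg_mono:
  fixes f g h :: "real \<Rightarrow> real"
  assumes f: "\<And>y. (f has_real_derivative g y) (at y)"
    and g: "\<And>y. (g has_real_derivative h y) (at y)"
    and h: "\<And>y. 0 \<le> h y" and "g x = 0"
    and uv: "x \<le> u \<and> u \<le> v \<or> v \<le> u \<and> u \<le> x"
  shows "f u \<le> f v"
proof -
  have g_mono: "g u \<le> g v" if "u \<le> v" for u v
    using DERIV_nonneg_imp_nondecreasing[OF that, of g] g h by blast
  show ?thesis
    using uv
  proof
    assume "x \<le> u \<and> u \<le> v"
    then show ?thesis
      by (intro DERIV_nonneg_imp_nondecreasing[of u v f])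
        (use f g_mono \<open>g x = 0\<close> order_trans in metis)+
  next
    assume "v \<le> u \<and> u \<le> x"
    then show ?thesis
      by (intro DERIV_nonpos_imp_nonincreasing[of v u f])
        (use f g_mono \<open>g x = 0\<close> order_trans in metis)+
  qed
qed

lemma second_deriv_nonneg_imp_min:
  fixes f g h :: "real \<Rightarrow> real"
  assumes "\<And>y. (f has_real_derivative g y) (at y)" "\<And>y. (g has_real_derivative h y) (at y)"
    and "\<And>y. 0 \<le> h y" "g x = 0"
  shows "f x \<le> f y"
  by (rule second_deriv_nonneg_mono[of f g h x, OF assms]) auto

text \<open>The function \<open>m / c\<^sup>2 * cosh (c * (y - x))\<close> has second derivative
  \<open>m * cosh (c * (y - x))\<close>, so adding or subtracting \<open>f\<close> leaves a convex
  function with critical point \<open>x\<close>. This becomes the contraction estimate of the fixed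
  point argument.\<close>

lemma second_deriv_cosh_bound:
  fixes f g h :: "real \<Rightarrow> real"
  assumes f: "\<And>y. (f has_real_derivative g y) (at y)"
    and g: "\<And>y. (g has_real_derivative h y) (at y)"
    and h: "\<And>y. \<bar>h y\<bar> \<le> m * cosh (c * (y - x))" and "f x = 0" "g x = 0" "0 < c"
  shows "\<bar>f y\<bar> \<le> m / c\<^sup>2 * cosh (c * (y - x))"
proof -
  have "0 \<le> m" using h[of x] by simp
  have "m / c\<^sup>2 * cosh (c * (x - x)) + e * f x \<le> m / c\<^sup>2 * cosh (c * (y - x)) + e * f y"
    if e: "e = 1 \<or> e = -1" for e
  proof (rule second_deriv_nonneg_imp_min[where f = "\<lambda>y. m / c\<^sup>2 * cosh (c * (y - x)) + e * f y"
        and g = "\<lambda>y. m / c * sinh (c * (y - x)) + e * g y" and h = "\<lambda>y. m * cosh (c * (y - x)) + e * h y"])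
    show "((\<lambda>y. m / c\<^sup>2 * cosh (c * (y - x)) + e * f y) has_real_derivative
        m / c * sinh (c * (y - x)) + e * g y) (at y)" for y
      using \<open>0 < c\<close> by (auto intro!: derivative_eq_intros f simp: field_simps power2_eq_square)
    show "((\<lambda>y. m / c * sinh (c * (y - x)) + e * g y) has_real_derivative
        m * cosh (c * (y - x)) + e * h y) (at y)" for y
      using \<open>0 < c\<close> by (auto intro!: derivative_eq_intros g simp: field_simps)
    show "0 \<le> m * cosh (c * (y - x)) + e * h y" for y
      using h[of y] e by (auto simp: abs_le_iff)
    show "m / c * sinh (c * (x - x)) + e * g x = 0"
      using \<open>g x = 0\<close> by simp
  qed
  from this[of 1] this[of "-1"]
  have "m / c\<^sup>2 \<le> m / c\<^sup>2 * cosh (c * (y - x)) + f y" "m / c\<^sup>2 \<le> m / c\<^sup>2 * cosh (c * (y - x)) - f y"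
    using \<open>f x = 0\<close> by auto
  moreover have "0 \<le> m / c\<^sup>2" using \<open>0 \<le> m\<close> by simp
  ultimately show ?thesis by linarith
qed

lemma has_real_derivative_interval_integral:
  fixes h :: "real \<Rightarrow> real"
  assumes "continuous_on UNIV h"
  shows "((\<lambda>y. LBINT s=ereal x..ereal y. h s) has_real_derivative h y) (at y)"
proof -
  let ?a = "min x y - 1" and ?b = "max x y + 1"
  have "((\<lambda>u. LBINT s=ereal x..ereal u. h s) has_vector_derivative h y) (at y within {?a..?b})"
    by (rule interval_integral_FTC2) (use assms in \<open>auto intro: continuous_on_subset\<close>)
  then have "((\<lambda>u. LBINT s=ereal x..ereal u. h s) has_vector_derivative h y) (at y)"
    by (subst (asm) at_within_interior) (auto simp: interior_cbox)
  then show ?thesis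
    by (simp add: has_real_derivative_iff_has_vector_derivative)
qed

abbreviation clip :: "real \<Rightarrow> real \<Rightarrow> real \<Rightarrow> real" where
  "clip p q y \<equiv> max p (min q y)"

text \<open>
  Banach's fixed point theorem in the sup norm weighted by \<open>1 / cosh\<close>, on the closed set of nonnegative
  functions. Evaluating the right-hand side at the clipped point keeps \<open>f''\<close> bounded and uniformly
  continuous on the whole line.
\<close>
lemma clipped_linear_ode:
  fixes \<kappa> :: "real \<Rightarrow> real"
  assumes \<kappa>: "continuous_on UNIV \<kappa>" "\<And>y. y \<in> {p..q} \<Longrightarrow> 0 \<le> \<kappa> y \<and> \<kappa> y \<le> c\<^sup>2"
    and x: "p \<le> x" "x \<le> q" and c: "0 < c"
  obtains f g where
    "\<And>y. (f has_real_derivative g y) (at y)"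
    "\<And>y. (g has_real_derivative \<kappa> (clip p q y) * f (clip p q y)) (at y)"
    "f x = 1" "g x = 0" "\<And>y. 1 \<le> f y"
proof -
  define cl where "cl = clip p q"
  \<comment> \<open>The rate is \<open>2 * c\<close> rather than \<open>c\<close>: two integrations
    divide by its square, so the bound \<open>c\<^sup>2\<close> on \<open>\<kappa>\<close> gives the
    contraction factor 1/4.\<close>
  define W where "W y = cosh (2 * c * (y - x))" for y
  define J where "J h y = (LBINT s=ereal x..ereal y. h s)" for h :: "real \<Rightarrow> real" and y
  \<comment> \<open>The unknown \<open>w\<close> is the quotient of the solution by the weight
    \<open>W\<close>, so \<open>H w\<close> is the prescribed second derivative.\<close>
  define H where "H w y = \<kappa> (cl y) * (W (cl y) * apply_bcontfun w (cl y))" for w y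
  define F where "F w y = 1 + J (J (H w)) y" for w y
  have cl_in: "cl y \<in> {p..q}" for y using x by (auto simp: cl_def)
  have cont_H: "continuous_on UNIV (H w)" for w
  proof -
    have *: "continuous_on UNIV (\<lambda>y. \<kappa> y * (W y * apply_bcontfun w y))"
      unfolding W_def by (intro continuous_intros \<kappa>) auto
    show ?thesis
      unfolding H_def by (rule continuous_on_compose2[OF *, of UNIV cl]) (auto simp: cl_def intro!: continuous_intros)
  qed
  have dJH: "(J (H w) has_real_derivative H w y) (at y)" for w y
    unfolding J_def[abs_def] by (rule has_real_derivative_interval_integral[OF cont_H])
  have cont_JH: "continuous_on UNIV (J (H w))" for w
    using dJH by (meson DERIV_continuous_on has_field_derivative_at_within)
  have dF: "(F w has_real_derivative J (H w) y) (at y)" for w y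
    unfolding F_def[abs_def]
    using DERIV_add[OF DERIV_const has_real_derivative_interval_integral[OF cont_JH], of 1 x w y]
    unfolding J_def[abs_def] by simp
  have J0: "J h x = 0" for h by (simp add: J_def)
  have W_pos: "0 < W y" for y by (simp add: W_def)
  have W1: "1 \<le> W y" for y unfolding W_def by (rule cosh_real_ge_1)
  \<comment> \<open>Clipping never increases the distance to \<open>x\<close>, because
    \<open>x\<close> lies in \<open>{p..q}\<close>.\<close>
  have W_cl: "W (cl y) \<le> W y" for y
  proof -
    have "\<bar>2 * c * (cl y - x)\<bar> \<le> \<bar>2 * c * (y - x)\<bar>"
      unfolding abs_mult using x c by (intro mult_left_mono) (auto simp: cl_def)
    then have "cosh \<bar>2 * c * (cl y - x)\<bar> \<le> cosh \<bar>2 * c * (y - x)\<bar>"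
      by (subst cosh_real_nonneg_le_iff) auto
    then show ?thesis by (simp add: W_def)
  qed
  have H_diff: "\<bar>H v y - H w y\<bar> \<le> c\<^sup>2 * dist v w * W y" for v w y
  proof -
    have eq: "\<bar>a * (b * u) - a * (b * u')\<bar> = a * (b * \<bar>u - u'\<bar>)" if "0 \<le> a" "0 \<le> b" for a b u u' :: real
      using that by (metis abs_mult abs_of_nonneg right_diff_distrib)
    have "\<bar>H v y - H w y\<bar> = \<kappa> (cl y) * (W (cl y) * \<bar>apply_bcontfun v (cl y) - apply_bcontfun w (cl y)\<bar>)"
      unfolding H_def by (rule eq) (use \<kappa>(2)[OF cl_in] less_imp_le[OF W_pos] in auto)
    also have "\<dots> \<le> c\<^sup>2 * (W y * dist v w)"
      using \<kappa>(2)[OF cl_in, of y] W_cl[of y] dist_bounded[of v "cl y" w, unfolded dist_real_def]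
      by (intro mult_mono mult_nonneg_nonneg less_imp_le[OF W_pos]) auto
    finally show ?thesis by (simp add: mult_ac)
  qed
  have F_diff: "\<bar>F v y - F w y\<bar> \<le> dist v w / 4 * W y" for v w y
  proof -
    have "\<bar>F v y - F w y\<bar> \<le> (c\<^sup>2 * dist v w) / (2 * c)\<^sup>2 * cosh (2 * c * (y - x))"
    proof (rule second_deriv_cosh_bound)
      show "((\<lambda>y. F v y - F w y) has_real_derivative J (H v) y - J (H w) y) (at y)" for y
        by (intro DERIV_diff dF)
      show "((\<lambda>y. J (H v) y - J (H w) y) has_real_derivative H v y - H w y) (at y)" for y
        by (intro DERIV_diff dJH)
    qed (use H_diff c in \<open>auto simp: F_def J0 W_def\<close>)
    then show ?thesis using c by (simp add: W_def power_mult_distrib)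
  qed
  define T where "T w = Bcontfun (\<lambda>y. F w y / W y)" for w
  have T_apply: "apply_bcontfun (T w) = (\<lambda>y. F w y / W y)" for w
  proof -
    have "continuous_on UNIV (F w)"
      using dF by (meson DERIV_continuous_on has_field_derivative_at_within)
    then have "continuous_on UNIV (\<lambda>y. F w y / W y)"
      using W_pos unfolding W_def by (intro continuous_intros) (auto simp: less_imp_neq[symmetric])
    \<comment> \<open>Boundedness follows by comparison with \<open>F 0\<close>, which is constantly
      1.\<close>
    moreover have "norm (F w y / W y) \<le> dist w 0 / 4 + 1" for y
    proof -
      have "H 0 = (\<lambda>_. 0)" by (simp add: H_def fun_eq_iff)
      then have "F 0 y = 1" by (simp add: F_def J_def)
      then have "\<bar>F w y\<bar> \<le> dist w 0 / 4 * W y + 1" using F_diff[of w y 0] by linarith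
      also have "\<dots> \<le> (dist w 0 / 4 + 1) * W y" using W1[of y] by (simp add: algebra_simps)
      finally show ?thesis using W_pos[of y] by (simp add: field_simps)
    qed
    ultimately have "(\<lambda>y. F w y / W y) \<in> bcontfun" by (rule bcontfun_normI)
    then show ?thesis by (simp add: T_def Bcontfun_inverse)
  qed
  let ?S = "{w :: real \<Rightarrow>\<^sub>C real. \<forall>y. 0 \<le> apply_bcontfun w y}"
  have "?S = PiC UNIV (\<lambda>_. {0..})" by (auto simp: mem_PiC_iff Pi_iff)
  then have "closed ?S" by (simp add: closed_PiC)
  have F_ge_1: "1 \<le> F w y" if "w \<in> ?S" for w y
  proof -
    have "0 \<le> H w y" for y
      using that \<kappa>(2)[OF cl_in, of y] W_pos[of "cl y"] by (auto simp: H_def)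
    then have "F w x \<le> F w y"
      by (intro second_deriv_nonneg_imp_min[OF dF dJH _ J0])
    then show ?thesis by (simp add: F_def J0)
  qed
  have "\<exists>!w\<in>?S. T w = w"
  proof (rule Banach_fix[where c = "1 / 4"])
    show "Topological_Spaces.complete ?S" using \<open>closed ?S\<close> by (simp add: complete_eq_closed)
    show "?S \<noteq> {}" by (auto intro: exI[of _ 0])
    show "T ` ?S \<subseteq> ?S"
    proof clarsimp
      fix w :: "real \<Rightarrow>\<^sub>C real" and y assume "\<forall>y. 0 \<le> apply_bcontfun w y"
      then show "0 \<le> apply_bcontfun (T w) y"
        using F_ge_1[of w y] W_pos[of y] by (simp add: T_apply)
    qed
    show "dist (T v) (T w) \<le> 1 / 4 * dist v w" for v w
    proof (rule dist_bound)
      fix y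
      show "dist (apply_bcontfun (T v) y) (apply_bcontfun (T w) y) \<le> 1 / 4 * dist v w"
        using F_diff[of v y w] W_pos[of y]
        by (simp add: T_apply dist_real_def flip: diff_divide_distrib) (simp add: field_simps)
    qed
  qed auto
  then obtain w where w: "w \<in> ?S" "T w = w" by blast
  have F_eq: "F w y = W y * apply_bcontfun w y" for y
    using T_apply[of w] W_pos[of y] unfolding w(2) by (simp add: field_simps)
  show ?thesis
  proof (rule that[of "F w" "J (H w)"])
    show "(J (H w) has_real_derivative \<kappa> (clip p q y) * F w (clip p q y)) (at y)" for y
      using dJH[of w y] by (simp add: H_def F_eq cl_def)
  qed (use dF F_ge_1 w in \<open>auto simp: J0 F_def\<close>)
qed

section \<open>Exponential growth of the solution\<close>

text \<open>The derivative of \<open>f * g * exp (- (2 * \<psi>))\<close> is a positive multiple of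
  a square, so this product is nondecreasing. It vanishes at \<open>x\<close>, so the comparison
  starts at distance \<open>1 / u\<close> from \<open>x\<close>, which costs the factor
  \<open>exp (- 1)\<close>. Passing from \<open>f * g\<close> to the square of \<open>f\<close> uses
  \<open>g \<le> u * f\<close> and leaves the factor \<open>l / u\<close>.\<close>

lemma linear_ode_growth:
  fixes f g k \<psi> :: "real \<Rightarrow> real"
  assumes f: "\<And>y. y \<in> {x..q} \<Longrightarrow> (f has_real_derivative g y) (at y)"
    and g: "\<And>y. y \<in> {x..q} \<Longrightarrow> (g has_real_derivative k y * f y) (at y)"
    and \<psi>: "\<And>y. y \<in> {x..q} \<Longrightarrow> (\<psi> has_real_derivative sqrt (k y)) (at y)"
    and k: "\<And>y. y \<in> {x..q} \<Longrightarrow> l\<^sup>2 \<le> k y \<and> k y \<le> u\<^sup>2"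
    and f_ge_1: "\<And>y. y \<in> {x..q} \<Longrightarrow> 1 \<le> f y"
    and init: "g x = 0" "\<psi> x = 0" and "x \<le> q" "0 < l" "0 < u"
  shows "l / u * exp (\<psi> q - 1) \<le> f q"
proof -
  have k_pos: "0 \<le> k y" if "y \<in> {x..q}" for y
    using k[OF that] zero_le_power2[of l] by linarith
  have "l \<le> u"
    using k[of x] \<open>x \<le> q\<close> \<open>0 < u\<close> power2_le_imp_le[of l u] by auto
  have g_lower: "l\<^sup>2 * (y - x) \<le> g y" if y: "y \<in> {x..q}" for y
  proof -
    have "g x - l\<^sup>2 * (x - x) \<le> g y - l\<^sup>2 * (y - x)"
    proof (rule DERIV_nonneg_imp_nondecreasing[where f = "\<lambda>z. g z - l\<^sup>2 * (z - x)"])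
      fix z assume "x \<le> z" "z \<le> y"
      then have z: "z \<in> {x..q}" using y by auto
      have "((\<lambda>z. g z - l\<^sup>2 * (z - x)) has_real_derivative k z * f z - l\<^sup>2) (at z)"
        by (auto intro!: derivative_eq_intros g[OF z])
      moreover have "l\<^sup>2 * 1 \<le> k z * f z"
        using k[OF z] f_ge_1[OF z] k_pos[OF z] by (intro mult_mono) auto
      ultimately show "\<exists>d. ((\<lambda>z. g z - l\<^sup>2 * (z - x)) has_real_derivative d) (at z) \<and> 0 \<le> d"
        by force
    qed (use y in auto)
    then show ?thesis using init by simp
  qed
  have g_nonneg: "0 \<le> g y" if y: "y \<in> {x..q}" for y
    by (rule order_trans[OF _ g_lower[OF y]]) (use y in simp)
  have \<psi>_upper: "\<psi> y \<le> u * (y - x)" if y: "y \<in> {x..q}" for y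
  proof -
    have "\<psi> y - u * (y - x) \<le> \<psi> x - u * (x - x)"
    proof (rule DERIV_nonpos_imp_nonincreasing[where f = "\<lambda>z. \<psi> z - u * (z - x)"])
      fix z assume "x \<le> z" "z \<le> y"
      then have z: "z \<in> {x..q}" using y by auto
      have "((\<lambda>z. \<psi> z - u * (z - x)) has_real_derivative sqrt (k z) - u) (at z)"
        by (auto intro!: derivative_eq_intros \<psi>[OF z])
      moreover have "sqrt (k z) \<le> u"
        using k[OF z] \<open>0 < u\<close> by (intro real_le_lsqrt) (auto intro: k_pos[OF z])
      ultimately show "\<exists>d. ((\<lambda>z. \<psi> z - u * (z - x)) has_real_derivative d) (at z) \<and> d \<le> 0"
        by force
    qed (use y in auto)
    then show ?thesis using init by simp
  qed
  have q: "q \<in> {x..q}" using \<open>x \<le> q\<close> by simp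
  show ?thesis
  proof (cases "q \<le> x + 1 / u")
    \<comment> \<open>Close to \<open>x\<close> the claimed lower bound is at most 1, since
      \<open>\<psi>\<close> has not yet exceeded 1.\<close>
    case True
    then have "u * (q - x) \<le> 1" using \<open>0 < u\<close> by (simp add: field_simps)
    then have "\<psi> q \<le> 1" using \<psi>_upper[OF q] by linarith
    then have "l / u * exp (\<psi> q - 1) \<le> 1 * 1"
      using \<open>0 < l\<close> \<open>l \<le> u\<close> by (intro mult_mono) auto
    then show ?thesis using f_ge_1[OF q] by simp
  next
    case False
    \<comment> \<open>At this point \<open>\<psi>\<close> is at most 1, while \<open>g\<close> has
      already grown to at least \<open>l\<^sup>2 / u\<close>.\<close>
    define y where "y = x + 1 / u"
    have y: "y \<in> {x..q}" using False \<open>0 < u\<close> by (auto simp: y_def)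
    have "f y * g y * exp (- (2 * \<psi> y)) \<le> f q * g q * exp (- (2 * \<psi> q))"
    proof (rule DERIV_nonneg_imp_nondecreasing[where f = "\<lambda>z. f z * g z * exp (- (2 * \<psi> z))"])
      fix z assume "y \<le> z" "z \<le> q"
      then have z: "z \<in> {x..q}" using y by auto
      have "((\<lambda>z. f z * g z * exp (- (2 * \<psi> z))) has_real_derivative
          exp (- (2 * \<psi> z)) * (g z - sqrt (k z) * f z)\<^sup>2) (at z)"
        using k_pos[OF z]
        by (auto intro!: derivative_eq_intros f[OF z] g[OF z] \<psi>[OF z]
            simp: power2_diff power_mult_distrib) (simp add: algebra_simps power2_eq_square)
      then show "\<exists>d. ((\<lambda>z. f z * g z * exp (- (2 * \<psi> z))) has_real_derivative d) (at z) \<and> 0 \<le> d"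
        by (intro exI conjI) auto
    qed (use y in auto)
    moreover have "l\<^sup>2 / u * exp (- 2) \<le> f y * g y * exp (- (2 * \<psi> y))"
    proof -
      have "1 * (l\<^sup>2 / u) \<le> f y * g y"
        using f_ge_1[OF y] g_lower[OF y] \<open>0 < u\<close> by (intro mult_mono) (auto simp: y_def)
      moreover have "\<psi> y \<le> 1" using \<psi>_upper[OF y] \<open>0 < u\<close> by (simp add: y_def)
      ultimately show ?thesis
        using f_ge_1[OF y] g_nonneg[OF y] by (intro mult_mono) auto
    qed
    ultimately have "l\<^sup>2 / u * exp (- 2) \<le> f q * g q * exp (- (2 * \<psi> q))" by linarith
    then have "l\<^sup>2 / u * exp (- 2) * exp (2 * \<psi> q) \<le> f q * g q * exp (- (2 * \<psi> q)) * exp (2 * \<psi> q)"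
      by (intro mult_right_mono) auto
    then have fg: "l\<^sup>2 / u * exp (2 * \<psi> q - 2) \<le> f q * g q"
      by (simp add: mult.assoc flip: exp_add)
    \<comment> \<open>The energy \<open>u\<^sup>2 * (f z)\<^sup>2 - (g z)\<^sup>2\<close> is
      nondecreasing because \<open>k\<close> is at most \<open>u\<^sup>2\<close>, and it is
      nonnegative at \<open>x\<close>, where \<open>g\<close> vanishes.\<close>
    have "g q \<le> u * f q"
    proof -
      have "u\<^sup>2 * (f x)\<^sup>2 - (g x)\<^sup>2 \<le> u\<^sup>2 * (f q)\<^sup>2 - (g q)\<^sup>2"
      proof (rule DERIV_nonneg_imp_nondecreasing[where f = "\<lambda>z. u\<^sup>2 * (f z)\<^sup>2 - (g z)\<^sup>2"])
        fix z assume "x \<le> z" "z \<le> q"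
        then have z: "z \<in> {x..q}" by auto
        have "((\<lambda>z. u\<^sup>2 * (f z)\<^sup>2 - (g z)\<^sup>2) has_real_derivative 2 * f z * g z * (u\<^sup>2 - k z)) (at z)"
          by (auto intro!: derivative_eq_intros f[OF z] g[OF z] simp: algebra_simps)
        moreover have "0 \<le> 2 * f z * g z * (u\<^sup>2 - k z)"
          using f_ge_1[OF z] g_nonneg[OF z] k[OF z] by (intro mult_nonneg_nonneg) auto
        ultimately show "\<exists>d. ((\<lambda>z. u\<^sup>2 * (f z)\<^sup>2 - (g z)\<^sup>2) has_real_derivative d) (at z) \<and> 0 \<le> d"
          by blast
      qed (use \<open>x \<le> q\<close> in auto)
      moreover have "0 \<le> u\<^sup>2 * (f x)\<^sup>2" by simp
      moreover have "(g x)\<^sup>2 = 0" using init by simp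
      ultimately have "(g q)\<^sup>2 \<le> (u * f q)\<^sup>2"
        unfolding power_mult_distrib by linarith
      then show ?thesis
        by (rule power2_le_imp_le) (use f_ge_1[OF q] \<open>0 < u\<close> in \<open>auto intro: mult_nonneg_nonneg\<close>)
    qed
    then have "f q * g q \<le> f q * (u * f q)"
      using f_ge_1[OF q] by (intro mult_left_mono) auto
    with fg have "l\<^sup>2 / u * exp (2 * \<psi> q - 2) / u \<le> f q * (u * f q) / u"
      using \<open>0 < u\<close> by (intro divide_right_mono) auto
    moreover have "exp (2 * \<psi> q - 2) = (exp (\<psi> q - 1))\<^sup>2"
      by (simp add: power2_eq_square flip: exp_add)
    ultimately have "(l / u * exp (\<psi> q - 1))\<^sup>2 \<le> (f q)\<^sup>2"
      using \<open>0 < u\<close> by (simp add: power2_eq_square mult_ac)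
    then show ?thesis
      by (rule power2_le_imp_le) (use f_ge_1[OF q] in auto)
  qed
qed

section \<open>Discretised Brownian motion\<close>

text \<open>The Lagrange remainder involves \<open>h t\<close> with \<open>t\<close> between
  \<open>y\<close> and \<open>y + z\<close>. If \<open>t\<close> is within \<open>d\<close> of
  \<open>y\<close>, the modulus of continuity applies. Otherwise \<open>z\<close> is larger than
  \<open>d\<close>, and the crude bound \<open>m\<close> is paid for by a quartic term, whose
  Gaussian mean is of higher order in the time step.\<close>

lemma quadratic_taylor_bound:
  fixes f g h :: "real \<Rightarrow> real"
  assumes f: "\<And>y. (f has_real_derivative g y) (at y)"
    and g: "\<And>y. (g has_real_derivative h y) (at y)"
    and h: "\<And>y. 0 \<le> h y" "\<And>y. h y \<le> m"
    and near: "\<And>v. \<bar>v - y\<bar> < d \<Longrightarrow> h v \<le> h y + \<epsilon>" and "0 < d" "0 < \<epsilon>"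
  shows "f (y + z) \<le> f y + g y * z + (h y + \<epsilon>) / 2 * z\<^sup>2 + m / (2 * d\<^sup>2) * z ^ 4"
proof (cases "z = 0")
  case False
  have "0 \<le> m" using h[of y] by linarith
  define D where "D n = (if n = 0 then f else if n = 1 then g else h)" for n :: nat
  have "\<exists>t. (if y + z < y then y + z < t \<and> t < y else y < t \<and> t < y + z) \<and>
      f (y + z) = (\<Sum>i<2. D i y / fact i * (y + z - y) ^ i) + D 2 t / fact 2 * (y + z - y) ^ 2"
    by (rule Taylor[where a = "min y (y + z)" and b = "max y (y + z)"])
       (use False in \<open>auto simp: D_def f g less_2_cases_iff\<close>)
  then obtain t where t': "if y + z < y then y + z < t \<and> t < y else y < t \<and> t < y + z"
    and eq': "f (y + z) = (\<Sum>i<2. D i y / fact i * (y + z - y) ^ i) + D 2 t / fact 2 * (y + z - y) ^ 2"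
    by blast
  from t' have t: "\<bar>t - y\<bar> < \<bar>z\<bar>" by (auto split: if_splits)
  have eq: "f (y + z) = f y + g y * z + h t / 2 * z\<^sup>2"
    using eq' by (simp add: D_def numeral_2_eq_2)
  have "h t * z\<^sup>2 \<le> (h y + \<epsilon>) * z\<^sup>2 + m / d\<^sup>2 * z ^ 4"
  proof (cases "\<bar>t - y\<bar> < d")
    case True
    then have "h t * z\<^sup>2 \<le> (h y + \<epsilon>) * z\<^sup>2" by (intro mult_right_mono near) auto
    moreover have "0 \<le> m / d\<^sup>2 * z ^ 4" using \<open>0 \<le> m\<close> by simp
    ultimately show ?thesis by linarith
  next
    case False
    then have "d\<^sup>2 \<le> z\<^sup>2" using t \<open>0 < d\<close> abs_le_square_iff[of d z] by auto
    then have "1 \<le> z\<^sup>2 / d\<^sup>2" using \<open>0 < d\<close> by simp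
    then have "m * z\<^sup>2 * 1 \<le> m * z\<^sup>2 * (z\<^sup>2 / d\<^sup>2)" using \<open>0 \<le> m\<close> by (intro mult_left_mono) auto
    moreover have "h t * z\<^sup>2 \<le> m * z\<^sup>2" by (intro mult_right_mono h) auto
    moreover have "0 \<le> (h y + \<epsilon>) * z\<^sup>2" using h(1)[of y] \<open>0 < \<epsilon>\<close> by (intro mult_nonneg_nonneg) auto
    ultimately show ?thesis by (simp add: power4_eq_xxxx power2_eq_square)
  qed
  then have "h t / 2 * z\<^sup>2 \<le> ((h y + \<epsilon>) * z\<^sup>2 + m / d\<^sup>2 * z ^ 4) / 2" by simp
  also have "\<dots> = (h y + \<epsilon>) / 2 * z\<^sup>2 + m / (2 * d\<^sup>2) * z ^ 4" by (simp add: algebra_simps add_divide_distrib)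
  finally show ?thesis unfolding eq by simp
qed simp

text \<open>The centred Gaussian moments of orders 0, 1, 2 and 4 are 1, 0, \<open>s\<^sup>2\<close>
  and \<open>3 * s ^ 4\<close>, so the linear term drops out.\<close>

lemma normal_quartic_nn_integral:
  fixes F :: "real \<Rightarrow> real"
  assumes "0 < s" and F: "\<And>z. 0 \<le> F z" "F \<in> borel_measurable borel"
    and le: "\<And>z. F z \<le> c0 + c1 * z + c2 * z\<^sup>2 + c4 * z ^ 4"
  shows "(\<integral>\<^sup>+z. ennreal (F z) \<partial>density lborel (normal_density 0 s)) \<le> ennreal (c0 + c2 * s\<^sup>2 + 3 * c4 * s ^ 4)"
proof -
  let ?P = "\<lambda>z. c0 + c1 * z + c2 * z\<^sup>2 + c4 * z ^ 4"
  let ?n = "normal_density 0 s"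
  have m0: "has_bochner_integral lborel (\<lambda>z. ?n z * z ^ 0) 1"
    using normal_moment_even[OF \<open>0 < s\<close>, of 0 0] by simp
  have m1: "has_bochner_integral lborel (\<lambda>z. ?n z * z) 0"
    using normal_moment_odd[OF \<open>0 < s\<close>, of 0 0] by simp
  have m2: "has_bochner_integral lborel (\<lambda>z. ?n z * z\<^sup>2) (s\<^sup>2)"
    using normal_moment_even[OF \<open>0 < s\<close>, of 0 1] by (simp add: fact_numeral)
  have m4: "has_bochner_integral lborel (\<lambda>z. ?n z * z ^ 4) (3 * s ^ 4)"
  proof -
    have "fact (2 * 2) / ((2 / s\<^sup>2) ^ 2 * fact 2) = 3 * s ^ 4"
      using \<open>0 < s\<close> by (simp add: fact_numeral field_simps)
    then show ?thesis using normal_moment_even[OF \<open>0 < s\<close>, of 0 2] by simp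
  qed
  have "has_bochner_integral lborel
      (\<lambda>z. c0 * (?n z * z ^ 0) + c1 * (?n z * z) + c2 * (?n z * z\<^sup>2) + c4 * (?n z * z ^ 4))
      (c0 * 1 + c1 * 0 + c2 * s\<^sup>2 + c4 * (3 * s ^ 4))"
    by (intro has_bochner_integral_add has_bochner_integral_mult_right m0 m1 m2 m4)
  then have int: "has_bochner_integral lborel (\<lambda>z. ?n z * ?P z) (c0 + c2 * s\<^sup>2 + 3 * c4 * s ^ 4)"
    by (rule has_bochner_integral_cong[THEN iffD1, rotated 3]) (auto simp: algebra_simps)
  have P_nonneg: "0 \<le> ?P z" for z using F(1)[of z] le[of z] by linarith
  have "(\<integral>\<^sup>+z. ennreal (F z) \<partial>density lborel ?n) = (\<integral>\<^sup>+z. ennreal (?n z) * ennreal (F z) \<partial>lborel)"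
    using F by (subst nn_integral_density) auto
  also have "\<dots> \<le> (\<integral>\<^sup>+z. ennreal (?n z * ?P z) \<partial>lborel)"
    using le F by (intro nn_integral_mono) (auto simp: ennreal_mult'[symmetric] intro!: ennreal_leI mult_left_mono)
  also have "\<dots> = ennreal (c0 + c2 * s\<^sup>2 + 3 * c4 * s ^ 4)"
    using int P_nonneg
    by (subst nn_integral_eq_integral) (auto simp: has_bochner_integral_iff)
  finally show ?thesis .
qed

text \<open>\<open>U n\<close> depends only on the first \<open>n\<close> innovations and is thus
  independent of \<open>\<xi> n\<close>. By Tonelli the one-step inequality, assumed for each fixed
  state, may be averaged over the law of \<open>U n\<close>; no filtration or conditional
  expectation enters.\<close>

lemma (in prob_space) random_recursion_supermartingale:
  fixes \<xi> :: "nat \<Rightarrow> 'a \<Rightarrow> real" and U :: "nat \<Rightarrow> 'a \<Rightarrow> 'u" and V :: "'u \<Rightarrow> ennreal"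
  assumes indep: "indep_vars (\<lambda>_. borel) \<xi> UNIV"
    and U_0: "\<And>\<omega>. U 0 \<omega> = v" and U_Suc: "\<And>i \<omega>. U (Suc i) \<omega> = step (U i \<omega>) (\<xi> i \<omega>)"
    and v: "v \<in> space N"
    and step [measurable]: "(\<lambda>(u, z). step u z) \<in> N \<Otimes>\<^sub>M borel \<rightarrow>\<^sub>M N"
    and V [measurable]: "V \<in> borel_measurable N"
    and super: "\<And>i u. u \<in> space N \<Longrightarrow> (\<integral>\<^sup>+z. V (step u z) \<partial>distr M borel (\<xi> i)) \<le> V u"
  shows "U n \<in> M \<rightarrow>\<^sub>M N" and "(\<integral>\<^sup>+\<omega>. V (U n \<omega>) \<partial>M) \<le> V v"
proof -
  have \<xi> [measurable]: "\<xi> i \<in> borel_measurable M" for i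
    using indep by (simp add: indep_vars_def)
  have meas_U [measurable]: "U n \<in> M \<rightarrow>\<^sub>M N" for n
  proof (induction n)
    case 0
    then show ?case using v by (simp add: U_0)
  next
    case (Suc n)
    show ?case
      using measurable_compose[OF measurable_Pair[OF Suc \<xi>] step] by (simp add: U_Suc[abs_def])
  qed
  \<comment> \<open>The recursion as a deterministic function of the noise sequence, so that
    \<open>U n\<close> factors through the product space over \<open>{..<n}\<close>.\<close>
  define F where "F n x = rec_nat v (\<lambda>i u. step u (x i)) n" for n and x :: "nat \<Rightarrow> real"
  have F_Suc: "F (Suc n) x = step (F n x) (x n)" for n x by (simp add: F_def)
  have meas_F: "F m \<in> PiM {..<n} (\<lambda>_. borel) \<rightarrow>\<^sub>M N" if "m \<le> n" for m n
    using that
  proof (induction m)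
    case 0
    then show ?case using v by (simp add: F_def)
  next
    case (Suc m)
    then have Fm: "F m \<in> PiM {..<n} (\<lambda>_. borel) \<rightarrow>\<^sub>M N" by simp
    have xm: "(\<lambda>x. x m) \<in> borel_measurable (PiM {..<n} (\<lambda>_. borel :: real measure))"
      using Suc.prems by (intro measurable_component_singleton) auto
    show ?case
      using measurable_compose[OF measurable_Pair[OF Fm xm] step] by (simp add: F_Suc[abs_def])
  qed
  have U_eq: "U m \<omega> = F m (restrict (\<lambda>i. \<xi> i \<omega>) {..<n})" if "m \<le> n" for m n \<omega>
    using that 
  proof (induction m)
    case 0
    then show ?case by (simp add: U_0 F_def)
  next
    case (Suc m)
    then show ?case by (simp add: F_Suc U_Suc)
  qed
  show "U n \<in> M \<rightarrow>\<^sub>M N" by (rule meas_U)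
  show "(\<integral>\<^sup>+\<omega>. V (U n \<omega>) \<partial>M) \<le> V v"
  proof (induction n)
    case 0
    then show ?case by (simp add: U_0 emeasure_space_1)
  next
    case (Suc n)
    let ?A = "PiM {..<n} (\<lambda>_. borel :: real measure)" and ?B = "PiM {n} (\<lambda>_. borel :: real measure)"
    let ?X = "\<lambda>\<omega>. \<lambda>i\<in>{..<n}. \<xi> i \<omega>" and ?Y = "\<lambda>\<omega>. \<lambda>i\<in>{n}. \<xi> i \<omega>"
    have [measurable]: "?X \<in> M \<rightarrow>\<^sub>M ?A" "?Y \<in> M \<rightarrow>\<^sub>M ?B"
      by (intro measurable_restrict \<xi>)+
    have yn [measurable]: "(\<lambda>y. y n) \<in> borel_measurable ?B"
      by (intro measurable_component_singleton) simp
    have Fn [measurable]: "F n \<in> ?A \<rightarrow>\<^sub>M N" by (rule meas_F) simp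
    have U_n: "U n = (\<lambda>\<omega>. F n (?X \<omega>))" by (rule ext, rule U_eq) simp
    interpret Y: prob_space "distr M ?B ?Y" by (rule prob_space_distr) simp
    have "indep_var ?A ?X ?B ?Y"
      using indep by (rule indep_var_restrict) auto
    then have prod: "distr M (?A \<Otimes>\<^sub>M ?B) (\<lambda>\<omega>. (?X \<omega>, ?Y \<omega>)) = distr M ?A ?X \<Otimes>\<^sub>M distr M ?B ?Y"
      by (simp add: indep_var_distribution_eq)
    have [measurable]: "(\<lambda>(x, y). V (step (F n x) (y n))) \<in> borel_measurable (?A \<Otimes>\<^sub>M ?B)"
      using measurable_compose[OF measurable_compose[OF measurable_Pair[OF
            measurable_compose[OF measurable_fst Fn] measurable_compose[OF measurable_snd yn]] step] V]
      by (simp add: case_prod_unfold)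
    have "(\<integral>\<^sup>+\<omega>. V (U (Suc n) \<omega>) \<partial>M) = (\<integral>\<^sup>+\<omega>. (case (?X \<omega>, ?Y \<omega>) of (x, y) \<Rightarrow> V (step (F n x) (y n))) \<partial>M)"
      unfolding U_Suc U_n by simp
    also have "\<dots> = (\<integral>\<^sup>+w. (case w of (x, y) \<Rightarrow> V (step (F n x) (y n))) \<partial>distr M (?A \<Otimes>\<^sub>M ?B) (\<lambda>\<omega>. (?X \<omega>, ?Y \<omega>)))"
      by (rule nn_integral_distr[symmetric]) measurable
    also have "\<dots> = (\<integral>\<^sup>+x. \<integral>\<^sup>+y. V (step (F n x) (y n)) \<partial>distr M ?B ?Y \<partial>distr M ?A ?X)"
      unfolding prod by (subst Y.nn_integral_fst[symmetric]) auto
    also have "\<dots> \<le> (\<integral>\<^sup>+x. V (F n x) \<partial>distr M ?A ?X)"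
    proof (rule nn_integral_mono)
      fix x assume "x \<in> space (distr M ?A ?X)"
      then have [simp]: "F n x \<in> space N" by (auto intro: measurable_space[of "F n" ?A])
      have [measurable]: "(\<lambda>z. V (step (F n x) z)) \<in> borel_measurable borel"
        using measurable_compose[OF measurable_Pair1'[of "F n x" N borel] measurable_compose[OF step V]]
        by simp
      have "(\<integral>\<^sup>+y. V (step (F n x) (y n)) \<partial>distr M ?B ?Y) = (\<integral>\<^sup>+z. V (step (F n x) z) \<partial>distr M borel (\<xi> n))"
        by (simp add: nn_integral_distr)
      then show "(\<integral>\<^sup>+y. V (step (F n x) (y n)) \<partial>distr M ?B ?Y) \<le> V (F n x)"
        using super[of "F n x" n] by simp
    qed
    also have "\<dots> = (\<integral>\<^sup>+\<omega>. V (U n \<omega>) \<partial>M)"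
      unfolding U_n by (rule nn_integral_distr) measurable
    finally show ?case using Suc by simp
  qed
qed

text \<open>This is the discrete substitute for the Ito formula: to leading order the mean grows by
  \<open>s\<^sup>2 / 2\<close> times the second derivative \<open>\<kappa> * f\<close>. Since
  \<open>\<kappa> * f\<close> is at least \<open>l\<close>, the error terms fit into the surplus
  factor \<open>\<theta> > 1\<close>, uniformly in \<open>y\<close>. Clipping controls the second
  derivative also where \<open>y + z\<close> leaves the interval.\<close>

lemma gaussian_step_bound:
  fixes f g \<kappa> :: "real \<Rightarrow> real"
  assumes \<kappa>: "continuous_on {p..q} \<kappa>" "\<And>y. y \<in> {p..q} \<Longrightarrow> l \<le> \<kappa> y" and "0 < l" "p \<le> q" "1 < \<theta>"
    and f: "\<And>y. (f has_real_derivative g y) (at y)"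
    and g: "\<And>y. (g has_real_derivative \<kappa> (clip p q y) * f (clip p q y)) (at y)"
    and f_ge_1: "\<And>y. 1 \<le> f y"
  shows "\<forall>\<^sub>F s in at_right 0. \<forall>y\<in>{p..q}.
      (\<integral>\<^sup>+z. ennreal (f (y + z)) \<partial>density lborel (normal_density 0 s)) \<le> ennreal (exp (\<theta> * (s\<^sup>2 * \<kappa> y / 2)) * f y)"
proof -
  define h where "h y = \<kappa> (clip p q y) * f (clip p q y)" for y
  have cont_f: "continuous_on S f" for S
    using f by (meson DERIV_continuous_on has_field_derivative_at_within)
  have cl_in: "clip p q y \<in> {p..q}" for y using \<open>p \<le> q\<close> by auto
  have cl_id: "clip p q y = y" if "y \<in> {p..q}" for y using that by auto
  have h_lower: "l \<le> h y" for y
  proof -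
    have "l * 1 \<le> h y"
      unfolding h_def using \<kappa>(2)[OF cl_in] f_ge_1 \<open>0 < l\<close>
      by (intro mult_mono) (auto intro: order_trans[of 0 l])
    then show ?thesis by simp
  qed
  have cont: "continuous_on {p..q} (\<lambda>y. \<kappa> y * f y)"
    by (intro continuous_intros \<kappa> cont_f)
  then have "bounded ((\<lambda>y. \<kappa> y * f y) ` {p..q})"
    by (intro compact_imp_bounded compact_continuous_image) auto
  then obtain m where "0 < m" and m: "\<And>y. y \<in> {p..q} \<Longrightarrow> \<bar>\<kappa> y * f y\<bar> \<le> m"
    unfolding bounded_pos by auto
  have h_upper: "h y \<le> m" for y
    using m[OF cl_in, of y] unfolding h_def by linarith
  \<comment> \<open>The surplus \<open>(\<theta> - 1) * l\<close> is split in two: one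
    \<open>\<epsilon>\<close> for the oscillation of \<open>h\<close>, the other for the quartic
    term.\<close>
  define \<epsilon> where "\<epsilon> = (\<theta> - 1) * l / 2"
  have \<epsilon>2: "2 * \<epsilon> = \<theta> * l - l" by (simp add: \<epsilon>_def left_diff_distrib)
  have "0 < \<epsilon>" using \<open>1 < \<theta>\<close> \<open>0 < l\<close> by (simp add: \<epsilon>_def)
  have "uniformly_continuous_on {p..q} (\<lambda>y. \<kappa> y * f y)"
    using cont by (intro compact_uniformly_continuous) auto
  then obtain d where "0 < d" and d: "\<And>u v. u \<in> {p..q} \<Longrightarrow> v \<in> {p..q} \<Longrightarrow> dist v u < d \<Longrightarrow>
      dist (\<kappa> v * f v) (\<kappa> u * f u) < \<epsilon>"
    unfolding uniformly_continuous_on_def using \<open>0 < \<epsilon>\<close> by metis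
  have near: "h v \<le> h y + \<epsilon>" if "\<bar>v - y\<bar> < d" for v y
  proof -
    have "dist (clip p q v) (clip p q y) < d" using that by (auto simp: dist_real_def)
    from d[OF cl_in cl_in this] show ?thesis unfolding h_def dist_real_def by linarith
  qed
  have "((\<lambda>s. 3 * m / (2 * d\<^sup>2) * s\<^sup>2) \<longlongrightarrow> 3 * m / (2 * d\<^sup>2) * 0\<^sup>2) (at_right 0)"
    by (intro tendsto_intros)
  then have "\<forall>\<^sub>F s in at_right 0. 3 * m / (2 * d\<^sup>2) * s\<^sup>2 < \<epsilon> / 2"
    by (rule order_tendstoD) (use \<open>0 < \<epsilon>\<close> in simp)
  then show ?thesis
    using eventually_at_right_less[of 0]
  proof eventually_elim
    case (elim s)
    show ?case
    proof
      fix y assume y: "y \<in> {p..q}"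
      have h_y: "h y = \<kappa> y * f y" unfolding h_def cl_id[OF y] ..
      have "(\<integral>\<^sup>+z. ennreal (f (y + z)) \<partial>density lborel (normal_density 0 s))
          \<le> ennreal (f y + (h y + \<epsilon>) / 2 * s\<^sup>2 + 3 * (m / (2 * d\<^sup>2)) * s ^ 4)"
      proof (rule normal_quartic_nn_integral)
        show "f (y + z) \<le> f y + g y * z + (h y + \<epsilon>) / 2 * z\<^sup>2 + m / (2 * d\<^sup>2) * z ^ 4" for z
          by (rule quadratic_taylor_bound[OF f _ _ h_upper near \<open>0 < d\<close> \<open>0 < \<epsilon>\<close>])
             (use g h_lower \<open>0 < l\<close> in \<open>auto simp: h_def intro: order_trans[of 0 l]\<close>)
        show "0 \<le> f (y + z)" for z using f_ge_1[of "y + z"] by simp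
        show "(\<lambda>z. f (y + z)) \<in> borel_measurable borel"
          by (intro borel_measurable_continuous_onI continuous_on_compose2[OF cont_f[of UNIV]] continuous_intros) auto
      qed (use elim in simp)
      also have "\<dots> \<le> ennreal (exp (\<theta> * (s\<^sup>2 * \<kappa> y / 2)) * f y)"
      proof (rule ennreal_leI)
        have "3 * (m / (2 * d\<^sup>2)) * s ^ 4 = s\<^sup>2 * (3 * m / (2 * d\<^sup>2) * s\<^sup>2)"
          by (simp add: power4_eq_xxxx power2_eq_square)
        also have "\<dots> \<le> s\<^sup>2 * (\<epsilon> / 2)" using elim by (intro mult_left_mono) auto
        finally have "f y + (h y + \<epsilon>) / 2 * s\<^sup>2 + 3 * (m / (2 * d\<^sup>2)) * s ^ 4
            \<le> f y + (h y + \<epsilon>) / 2 * s\<^sup>2 + s\<^sup>2 * (\<epsilon> / 2)"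
          by simp
        also have "\<dots> = f y + s\<^sup>2 / 2 * (h y + 2 * \<epsilon>)"
          by (simp add: algebra_simps add_divide_distrib)
        also have "h y + 2 * \<epsilon> \<le> \<theta> * h y"
          using mult_left_mono[OF h_lower[of y], of "\<theta> - 1"] \<open>1 < \<theta>\<close> \<epsilon>2 by (simp add: algebra_simps)
        also have "f y + s\<^sup>2 / 2 * (\<theta> * h y) = (1 + \<theta> * (s\<^sup>2 * \<kappa> y / 2)) * f y"
          by (simp add: h_y algebra_simps)
        also have "\<dots> \<le> exp (\<theta> * (s\<^sup>2 * \<kappa> y / 2)) * f y"
          using f_ge_1[of y] by (intro mult_right_mono exp_ge_add_one_self) auto
        finally show "f y + (h y + \<epsilon>) / 2 * s\<^sup>2 + 3 * (m / (2 * d\<^sup>2)) * s ^ 4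
            \<le> exp (\<theta> * (s\<^sup>2 * \<kappa> y / 2)) * f y"
          by (simp add: mult_left_mono)
      qed
      finally show "(\<integral>\<^sup>+z. ennreal (f (y + z)) \<partial>density lborel (normal_density 0 s))
          \<le> ennreal (exp (\<theta> * (s\<^sup>2 * \<kappa> y / 2)) * f y)" .
    qed
  qed
qed

section \<open>Riemann sums and the sampled, frozen path\<close>

text \<open>The mean value theorem on each cell replaces the increment of \<open>A\<close> by a
  value of \<open>\<phi>\<close> within \<open>h\<close> of the left end point. Left end points are
  used because the sampled clock advances according to the position before the step.\<close>

lemma left_riemann_sum_le:
  fixes A \<phi> :: "real \<Rightarrow> real"
  assumes A: "\<And>s. (A has_real_derivative \<phi> s) (at s)"
    and \<phi>: "\<And>s t. s \<in> {0..T} \<Longrightarrow> t \<in> {0..T} \<Longrightarrow> \<bar>s - t\<bar> \<le> h \<Longrightarrow> \<phi> s \<le> \<phi> t + \<epsilon>"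
    and "0 < h" "real m * h \<le> T"
  shows "(\<Sum>j<m. h * \<phi> (real j * h)) \<le> A (real m * h) - A 0 + \<epsilon> * (real m * h)"
  using \<open>real m * h \<le> T\<close>
proof (induction m)
  case (Suc m)
  have lt: "real m * h < real (Suc m) * h" using \<open>0 < h\<close> by (simp add: algebra_simps)
  obtain z where z: "real m * h < z" "z < real (Suc m) * h"
    and eq: "A (real (Suc m) * h) - A (real m * h) = (real (Suc m) * h - real m * h) * \<phi> z"
    using MVT2[OF lt, of A \<phi>] A by blast
  have "0 \<le> real m * h" using \<open>0 < h\<close> by simp
  have "\<phi> (real m * h) \<le> \<phi> z + \<epsilon>"
  proof (rule \<phi>)
    show "z \<in> {0..T}" "real m * h \<in> {0..T}"
      unfolding atLeastAtMost_iff using z Suc.prems \<open>0 \<le> real m * h\<close> lt by linarith+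
    show "\<bar>real m * h - z\<bar> \<le> h"
      using z by (simp add: algebra_simps)
  qed
  then have "h * \<phi> (real m * h) \<le> h * (\<phi> z + \<epsilon>)" using \<open>0 < h\<close> by simp
  moreover have "(\<Sum>j<m. h * \<phi> (real j * h)) \<le> A (real m * h) - A 0 + \<epsilon> * (real m * h)"
    using Suc.IH Suc.prems lt by linarith
  ultimately show ?case using eq by (simp add: algebra_simps)
qed simp

text \<open>The complement of \<open>{p..q}\<close> is open, so the path is still outside at the
  last grid point before \<open>T\<close> once the mesh is small. The strict inequality
  \<open>A T < c\<close> absorbs the error of the Riemann sum.\<close>

lemma riemann_exit_eventually:
  fixes b \<phi> A :: "real \<Rightarrow> real"
  assumes b: "continuous_on UNIV b" and \<phi>: "continuous_on UNIV \<phi>" "\<And>s. 0 \<le> \<phi> s"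
    and A: "\<And>s. (A has_real_derivative \<phi> s) (at s)" and "A 0 = 0"
    and T: "0 \<le> T" "b T \<notin> {p..q}" "A T < c"
  shows "\<forall>\<^sub>F h in at_right 0. \<exists>m. real m * h \<le> T \<and> b (real m * h) \<notin> {p..q} \<and>
      (\<Sum>j<m. h * \<phi> (real j * h)) \<le> c"
proof -
  have "open (- {p..q})" by auto
  then have "\<forall>\<^sub>F s in at T. b s \<in> - {p..q}"
    using b T(2) by (intro topological_tendstoD) (auto simp: continuous_on_def)
  then obtain d1 where "0 < d1" and d1: "\<And>s. dist s T < d1 \<Longrightarrow> b s \<notin> {p..q}"
    using T(2) unfolding eventually_at by (metis ComplD UNIV_I)
  \<comment> \<open>The error accumulated up to \<open>T\<close> then stays below
    \<open>c - A T\<close>; the added 1 covers \<open>T = 0\<close>.\<close>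
  define \<epsilon> where "\<epsilon> = (c - A T) / (T + 1)"
  have "0 < \<epsilon>" using T by (simp add: \<epsilon>_def)
  have "uniformly_continuous_on {0..T} \<phi>"
    using \<phi>(1) by (intro compact_uniformly_continuous) (auto intro: continuous_on_subset)
  then obtain d2 where "0 < d2" and d2: "\<And>s t. s \<in> {0..T} \<Longrightarrow> t \<in> {0..T} \<Longrightarrow> dist t s < d2 \<Longrightarrow> dist (\<phi> t) (\<phi> s) < \<epsilon>"
    unfolding uniformly_continuous_on_def using \<open>0 < \<epsilon>\<close> by metis
  have "\<forall>\<^sub>F h in at_right 0. h < min d1 d2"
    using \<open>0 < d1\<close> \<open>0 < d2\<close> by (intro order_tendstoD[OF tendsto_ident_at]) auto
  then show ?thesis
    using eventually_at_right_less[of 0]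
  proof eventually_elim
    case (elim h)
    define m where "m = nat \<lfloor>T / h\<rfloor>"
    have m: "real m \<le> T / h" "T / h < real m + 1"
      using T(1) elim by (auto simp: m_def)
    then have mh: "real m * h \<le> T" "T < real m * h + h"
      using elim by (auto simp: field_simps)
    have mh0: "0 \<le> real m * h" using elim by simp
    have "(\<Sum>j<m. h * \<phi> (real j * h)) \<le> A (real m * h) - A 0 + \<epsilon> * (real m * h)"
    proof (rule left_riemann_sum_le[OF A])
      fix s t assume "s \<in> {0..T}" "t \<in> {0..T}" "\<bar>s - t\<bar> \<le> h"
      then show "\<phi> s \<le> \<phi> t + \<epsilon>" using d2[of t s] elim by (auto simp: dist_real_def)
    qed (use elim mh in auto)
    also have "A (real m * h) \<le> A T"
      using DERIV_nonneg_imp_nondecreasing[OF mh(1), of A] A \<phi>(2) by blast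
    also have "\<epsilon> * (real m * h) \<le> \<epsilon> * (T + 1)"
      using mh \<open>0 < \<epsilon>\<close> by (intro mult_left_mono) auto
    also have "\<epsilon> * (T + 1) = c - A T" using T(1) by (simp add: \<epsilon>_def)
    finally have "(\<Sum>j<m. h * \<phi> (real j * h)) \<le> c" using \<open>A 0 = 0\<close> by simp
    moreover have "b (real m * h) \<notin> {p..q}"
      using mh elim by (intro d1) (auto simp: dist_real_def)
    ultimately show ?case using mh by blast
  qed
qed

text \<open>The increments telescope until the first exit and nothing changes afterwards. So
  \<open>i\<close> is the first exit index capped at \<open>n\<close>, and the recursion reproduces
  the stopped path together with its accumulated clock.\<close>

lemma frozen_recursion:
  fixes u :: "nat \<Rightarrow> real \<times> real"
  assumes u_0: "u 0 = (b 0, 0)"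
    and u_Suc: "\<And>i. u (Suc i) = (if fst (u i) \<in> I then (fst (u i) + (b (Suc i) - b i), snd (u i) + w (fst (u i))) else u i)"
  obtains i where "i \<le> n" "u n = (b i, \<Sum>j<i. w (b j))" "\<And>j. j < i \<Longrightarrow> b j \<in> I" "i < n \<Longrightarrow> b i \<notin> I"
proof -
  have "\<exists>i\<le>n. u n = (b i, \<Sum>j<i. w (b j)) \<and> (\<forall>j<i. b j \<in> I) \<and> (i < n \<longrightarrow> b i \<notin> I)"
  proof (induction n)
    case 0
    then show ?case by (simp add: u_0)
  next
    case (Suc n)
    then obtain i where i: "i \<le> n" "u n = (b i, \<Sum>j<i. w (b j))" "\<forall>j<i. b j \<in> I" "i < n \<longrightarrow> b i \<notin> I"
      by blast
    show ?case
    proof (cases "b i \<in> I")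
      case True
      then have "i = n" using i by (metis le_neq_implies_less)
      then show ?thesis
        using i True by (intro exI[of _ "Suc n"]) (auto simp: u_Suc less_Suc_eq)
    next
      case False
      then show ?thesis using i by (intro exI[of _ i]) (auto simp: u_Suc)
    qed
  qed
  then show ?thesis using that by blast
qed

text \<open>\<open>E\<close> itself need not be measurable; the proof encloses it in a measurable event.\<close>
lemma (in brownian_motion) exit_before_clock_bound:
  fixes \<kappa> f g :: "real \<Rightarrow> real"
  assumes \<kappa>: "continuous_on UNIV \<kappa>" "\<And>y. 0 \<le> \<kappa> y" "\<And>y. y \<in> {\<alpha>..\<beta>} \<Longrightarrow> l \<le> \<kappa> y" and "0 < l"
    and f: "\<And>y. (f has_real_derivative g y) (at y)"
    and g: "\<And>y. (g has_real_derivative \<kappa> (clip \<alpha> \<beta> y) * f (clip \<alpha> \<beta> y)) (at y)"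
    and f_ge_1: "\<And>y. 1 \<le> f y" and f_exit: "\<And>y. y \<notin> {\<alpha>..\<beta>} \<Longrightarrow> L \<le> f y" and "0 < L"
    and q: "q \<in> {\<alpha>..\<beta>}" and c: "0 < c" "c < c'"
    and E: "\<And>\<omega>. \<omega> \<in> E \<Longrightarrow> \<omega> \<in> space Q \<and>
      (\<exists>T\<ge>0. B T \<omega> \<notin> {\<alpha>..\<beta>} \<and> (LBINT s=ereal 0..ereal T. \<kappa> (B (max 0 s) \<omega>) / 2) < c)"
  shows "emeasure Q E \<le> ennreal (exp c' * f q / L)"
proof -
  \<comment> \<open>Chosen so that \<open>\<theta> * c = c'\<close>: the gap between the two clock
    levels pays for the discretisation error.\<close>
  define \<theta> where "\<theta> = c' / c"
  have "1 < \<theta>" using c by (simp add: \<theta>_def)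
  define k where "k n = 1 / real (Suc n)" for n
  define \<xi> where "\<xi> n i \<omega> = B (real (Suc i) * k n) \<omega> - B (real i * k n) \<omega>" for n i \<omega>
  \<comment> \<open>The state is the pair of position and elapsed clock, frozen once the position
    has left the interval.\<close>
  define step where "step n u z =
    (if fst u \<in> {\<alpha>..\<beta>} then (fst u + z, snd u + k n * (\<kappa> (fst u) / 2)) else u)" for n and u :: "real \<times> real" and z
  define U where "U n i \<omega> = rec_nat (q, 0) (\<lambda>i u. step n u (\<xi> n i \<omega>)) i" for n i \<omega>
  define V where "V u = ennreal (exp (- \<theta> * snd u) * f (fst u))" for u :: "real \<times> real"
  \<comment> \<open>With mesh \<open>1 / Suc n\<close>, this number of steps reaches time
    \<open>Suc n\<close>, hence eventually passes any given exit time.\<close>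
  define H where "H n = {\<omega> \<in> space Q. fst (U n (Suc n * Suc n) \<omega>) \<notin> {\<alpha>..\<beta>} \<and> snd (U n (Suc n * Suc n) \<omega>) \<le> c}" for n
  have k_pos: "0 < k n" for n by (simp add: k_def)
  have k_lim: "filterlim (\<lambda>n. k n) (at_right 0) sequentially"
    unfolding k_def filterlim_at
    using LIMSEQ_inverse_real_of_nat by (auto simp: inverse_eq_divide)
  have sqrt_k_lim: "filterlim (\<lambda>n. sqrt (k n)) (at_right 0) sequentially"
    unfolding filterlim_at
    using tendsto_real_sqrt[of k 0 sequentially] k_lim k_pos by (auto simp: filterlim_at)
  have sqrt_k_sq: "(sqrt (k n))\<^sup>2 = k n" for n using k_pos[of n] by simp
  have U_0: "U n 0 \<omega> = (q, 0)" for n \<omega> by (simp add: U_def)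
  have U_Suc: "U n (Suc i) \<omega> = step n (U n i \<omega>) (\<xi> n i \<omega>)" for n i \<omega> by (simp add: U_def)
  have [measurable]: "f \<in> borel_measurable borel" "\<kappa> \<in> borel_measurable borel"
    using f \<kappa>(1) by (auto intro!: borel_measurable_continuous_onI DERIV_continuous_on)
  have V_meas [measurable]: "V \<in> borel_measurable (borel \<Otimes>\<^sub>M borel)"
    unfolding V_def by measurable
  have step_meas [measurable]: "(\<lambda>(u, z). step n u z) \<in> (borel \<Otimes>\<^sub>M borel) \<Otimes>\<^sub>M borel \<rightarrow>\<^sub>M borel \<Otimes>\<^sub>M borel" for n
    unfolding step_def case_prod_unfold by measurable
  have \<xi>_indep: "indep_vars (\<lambda>_. borel) (\<xi> n) UNIV" for n
    unfolding \<xi>_def[abs_def]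
    by (rule indep_increments[of "\<lambda>i. real i * k n"])
       (use k_pos[of n] in \<open>auto simp: incseq_Suc_iff intro!: mult_right_mono\<close>)
  have \<xi>_distr: "distr Q borel (\<xi> n i) = density lborel (normal_density 0 (sqrt (k n)))" for n i
  proof -
    have "distributed Q lborel (\<xi> n i) (normal_density 0 (sqrt (real (Suc i) * k n - real i * k n)))"
      unfolding \<xi>_def[abs_def]
      by (rule normal_increments) (use k_pos[of n] in \<open>auto intro!: mult_strict_right_mono\<close>)
    then have "distr Q lborel (\<xi> n i) = density lborel (normal_density 0 (sqrt (k n)))"
      by (simp add: distributed_def algebra_simps)
    then show ?thesis by (metis distr_cong sets_lborel)
  qed
  have "\<forall>\<^sub>F n in sequentially. \<forall>y\<in>{\<alpha>..\<beta>}.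
      (\<integral>\<^sup>+z. ennreal (f (y + z)) \<partial>density lborel (normal_density 0 (sqrt (k n))))
        \<le> ennreal (exp (\<theta> * ((sqrt (k n))\<^sup>2 * \<kappa> y / 2)) * f y)"
    by (rule eventually_compose_filterlim[OF gaussian_step_bound sqrt_k_lim])
       (use \<kappa> \<open>0 < l\<close> q \<open>1 < \<theta>\<close> f g f_ge_1 in \<open>auto intro: continuous_on_subset\<close>)
  then obtain n0 where n0: "\<And>n y. n0 \<le> n \<Longrightarrow> y \<in> {\<alpha>..\<beta>} \<Longrightarrow>
      (\<integral>\<^sup>+z. ennreal (f (y + z)) \<partial>density lborel (normal_density 0 (sqrt (k n))))
        \<le> ennreal (exp (\<theta> * (k n * \<kappa> y / 2)) * f y)"
    unfolding eventually_sequentially sqrt_k_sq by blast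
  have super: "(\<integral>\<^sup>+z. V (step n u z) \<partial>distr Q borel (\<xi> n i)) \<le> V u" if "n0 \<le> n" for n i u
  proof (cases "fst u \<in> {\<alpha>..\<beta>}")
    case True
    define y where "y = fst u"
    define e where "e = exp (- \<theta> * (snd u + k n * (\<kappa> y / 2)))"
    have "(\<integral>\<^sup>+z. V (step n u z) \<partial>distr Q borel (\<xi> n i))
        = (\<integral>\<^sup>+z. ennreal e * ennreal (f (y + z)) \<partial>density lborel (normal_density 0 (sqrt (k n))))"
      using True f_ge_1 order_trans[OF zero_le_one f_ge_1]
      by (simp add: \<xi>_distr V_def step_def y_def e_def ennreal_mult)
    also have "\<dots> = ennreal e * (\<integral>\<^sup>+z. ennreal (f (y + z)) \<partial>density lborel (normal_density 0 (sqrt (k n))))"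
      by (rule nn_integral_cmult) measurable
    also have "\<dots> \<le> ennreal e * ennreal (exp (\<theta> * (k n * \<kappa> y / 2)) * f y)"
      using n0[OF that] True by (intro mult_left_mono) (auto simp: y_def)
    also have "\<dots> = ennreal (e * exp (\<theta> * (k n * \<kappa> y / 2)) * f y)"
      by (simp add: ennreal_mult' e_def mult.assoc)
    also have "e * exp (\<theta> * (k n * \<kappa> y / 2)) = exp (- \<theta> * snd u)"
      by (simp add: e_def algebra_simps flip: exp_add)
    finally show ?thesis by (simp add: V_def y_def)
  next
    case False
    interpret \<xi>: prob_space "distr Q borel (\<xi> n i)"
      using \<xi>_indep by (intro prob_space_distr) (simp add: indep_vars_def)
    have "step n u z = u" for z using False unfolding step_def by (rule if_not_P)
    then show ?thesis using \<xi>.emeasure_space_1 by simp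
  qed
  have chain: "U n i \<in> Q \<rightarrow>\<^sub>M borel \<Otimes>\<^sub>M borel" "(\<integral>\<^sup>+\<omega>. V (U n i \<omega>) \<partial>Q) \<le> V (q, 0)" if "n0 \<le> n" for n i
    using random_recursion_supermartingale[where U = "U n" and v = "(q, 0)", OF \<xi>_indep U_0 U_Suc _ step_meas V_meas super[OF that]]
    by (auto simp: space_pair_measure)
  have H_sets: "H n \<in> sets Q" if "n0 \<le> n" for n
  proof -
    note [measurable] = chain(1)[OF that]
    show ?thesis unfolding H_def by measurable
  qed
  \<comment> \<open>Markov's inequality: on \<open>H n\<close> the weight \<open>V\<close> is at
    least \<open>exp (- c') * L\<close>, while its mean is at most the initial value
    \<open>f q\<close>.\<close>
  have H_bound: "emeasure Q (H n) \<le> ennreal (exp c' * f q / L)" if "n0 \<le> n" for n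
  proof -
    note [measurable] = chain(1)[OF that]
    let ?U = "U n (Suc n * Suc n)"
    have "emeasure Q (H n) = (\<integral>\<^sup>+\<omega>. indicator (H n) \<omega> \<partial>Q)"
      using H_sets[OF that] by simp
    also have "\<dots> \<le> (\<integral>\<^sup>+\<omega>. ennreal (exp c' / L) * V (?U \<omega>) \<partial>Q)"
    proof (rule nn_integral_mono)
      fix \<omega> assume "\<omega> \<in> space Q"
      show "indicator (H n) \<omega> \<le> ennreal (exp c' / L) * V (?U \<omega>)"
      proof (cases "\<omega> \<in> H n")
        case True
        then have fL: "L \<le> f (fst (?U \<omega>))" and le: "snd (?U \<omega>) \<le> c" using f_exit by (auto simp: H_def)
        have "\<theta> * snd (?U \<omega>) \<le> \<theta> * c" using le \<open>1 < \<theta>\<close> by simp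
        also have "\<theta> * c = c'" using c by (simp add: \<theta>_def)
        finally have "exp (- c') * L \<le> exp (- \<theta> * snd (?U \<omega>)) * f (fst (?U \<omega>))"
          using fL \<open>0 < L\<close> by (intro mult_mono) auto
        then have "exp c' / L * (exp (- c') * L) \<le> exp c' / L * (exp (- \<theta> * snd (?U \<omega>)) * f (fst (?U \<omega>)))"
          using \<open>0 < L\<close> by (intro mult_left_mono) auto
        then have "1 \<le> exp c' / L * (exp (- \<theta> * snd (?U \<omega>)) * f (fst (?U \<omega>)))"
          using \<open>0 < L\<close> by (simp add: exp_minus)
        then show ?thesis
          using True \<open>0 < L\<close> by (simp add: V_def ennreal_mult'[symmetric])
      qed simp
    qed
    also have "\<dots> = ennreal (exp c' / L) * (\<integral>\<^sup>+\<omega>. V (?U \<omega>) \<partial>Q)"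
      by (rule nn_integral_cmult) measurable
    also have "\<dots> \<le> ennreal (exp c' / L) * V (q, 0)"
      by (intro mult_left_mono chain that) simp
    also have "\<dots> = ennreal (exp c' * f q / L)"
      using \<open>0 < L\<close> by (simp add: V_def ennreal_mult'[symmetric])
    finally show ?thesis .
  qed
  have E_H: "\<forall>\<^sub>F n in sequentially. \<omega> \<in> H n" if \<omega>_E: "\<omega> \<in> E" for \<omega>
  proof -
    obtain T where \<omega>: "\<omega> \<in> space Q" and T: "0 \<le> T" "B T \<omega> \<notin> {\<alpha>..\<beta>}"
      "(LBINT s=ereal 0..ereal T. \<kappa> (B (max 0 s) \<omega>) / 2) < c"
      using E[OF \<omega>_E] by blast
    \<comment> \<open>The path is extended by its initial value to negative times, which makes it
      continuous on the whole line.\<close>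
    define b where "b s = B (max 0 s) \<omega>" for s
    have b: "continuous_on UNIV b"
      unfolding b_def by (rule continuous_on_compose2[OF continuous_B[OF \<omega>]]) (auto intro!: continuous_intros)
    have \<kappa>b: "continuous_on UNIV (\<lambda>s. \<kappa> (b s) / 2)"
      by (intro continuous_intros continuous_on_compose2[OF \<kappa>(1) b]) auto
    have "\<forall>\<^sub>F n in sequentially. \<exists>m. real m * k n \<le> T \<and> b (real m * k n) \<notin> {\<alpha>..\<beta>} \<and>
        (\<Sum>j<m. k n * (\<kappa> (b (real j * k n)) / 2)) \<le> c"
      by (rule eventually_compose_filterlim[OF riemann_exit_eventually[OF b \<kappa>b _
              has_real_derivative_interval_integral[OF \<kappa>b]] k_lim])
         (use \<kappa>(2) T in \<open>auto simp: b_def\<close>)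
    moreover have "\<forall>\<^sub>F n in sequentially. T \<le> real (Suc n)"
      by (rule eventually_sequentiallyI[of "nat \<lceil>T\<rceil>"]) linarith
    ultimately show ?thesis
    proof eventually_elim
      case (elim n)
      then obtain m where m: "real m * k n \<le> T" "b (real m * k n) \<notin> {\<alpha>..\<beta>}"
        "(\<Sum>j<m. k n * (\<kappa> (b (real j * k n)) / 2)) \<le> c" by blast
      have "real m \<le> T * real (Suc n)" using m(1) by (simp add: k_def field_simps)
      also have "\<dots> \<le> real (Suc n) * real (Suc n)" using elim(2) by (intro mult_right_mono) auto
      finally have m_le: "m \<le> Suc n * Suc n" by (metis of_nat_le_iff of_nat_mult)
      have b_grid: "b (real i * k n) = B (real i * k n) \<omega>" for i
        using less_imp_le[OF k_pos] by (simp add: b_def max_def)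
      obtain i where i: "i \<le> Suc n * Suc n"
          "U n (Suc n * Suc n) \<omega> = (b (real i * k n), \<Sum>j<i. k n * (\<kappa> (b (real j * k n)) / 2))"
          "\<And>j. j < i \<Longrightarrow> b (real j * k n) \<in> {\<alpha>..\<beta>}" "i < Suc n * Suc n \<Longrightarrow> b (real i * k n) \<notin> {\<alpha>..\<beta>}"
      proof (rule frozen_recursion[where u = "\<lambda>i. U n i \<omega>" and b = "\<lambda>i. b (real i * k n)" and I = "{\<alpha>..\<beta>}"
            and w = "\<lambda>y. k n * (\<kappa> y / 2)" and n = "Suc n * Suc n"])
        show "U n 0 \<omega> = (b (real 0 * k n), 0)" using start_B[OF \<omega>] by (simp add: U_0 b_def)
        show "U n (Suc i) \<omega> = (if fst (U n i \<omega>) \<in> {\<alpha>..\<beta>}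
          then (fst (U n i \<omega>) + (b (real (Suc i) * k n) - b (real i * k n)), snd (U n i \<omega>) + k n * (\<kappa> (fst (U n i \<omega>)) / 2))
          else U n i \<omega>)" for i
          unfolding U_Suc step_def \<xi>_def b_grid ..
      qed (rule that)
      have "i \<le> m" using i(3) m(2) by (meson not_le)
      then have "(\<Sum>j<i. k n * (\<kappa> (b (real j * k n)) / 2)) \<le> (\<Sum>j<m. k n * (\<kappa> (b (real j * k n)) / 2))"
        using \<kappa>(2) less_imp_le[OF k_pos] by (intro sum_mono2) auto
      moreover have "b (real i * k n) \<notin> {\<alpha>..\<beta>}"
        using i(1,4) \<open>i \<le> m\<close> m_le m(2) by (metis le_antisym le_neq_implies_less order_trans)
      ultimately show ?case using m(3) \<omega> i(2) by (simp add: H_def)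
    qed
  qed
  \<comment> \<open>The union of this increasing sequence of measurable sets is the lower limit of
    the \<open>H i\<close>. It contains \<open>E\<close>, and its measure is obtained by continuity
    from below. Starting at \<open>n0\<close> keeps only meshes with the supermartingale
    property.\<close>
  define G where "G n = (\<Inter>i\<in>{max n n0..}. H i)" for n
  have G_sets: "G n \<in> sets Q" for n
    unfolding G_def by (intro sets.countable_INT') (auto intro: H_sets)
  have "E \<subseteq> (\<Union>n. G n)"
    using E_H unfolding G_def eventually_sequentially by fastforce
  then have "emeasure Q E \<le> emeasure Q (\<Union>n. G n)"
    using G_sets by (intro emeasure_mono) auto
  also have "\<dots> = (SUP n. emeasure Q (G n))"
    by (rule SUP_emeasure_incseq[symmetric]) (use G_sets in \<open>auto simp: G_def incseq_def\<close>)
  also have "\<dots> \<le> ennreal (exp c' * f q / L)"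
  proof (rule SUP_least)
    fix n
    have "emeasure Q (G n) \<le> emeasure Q (H (max n n0))"
      by (rule emeasure_mono) (auto simp: G_def intro: H_sets)
    also have "\<dots> \<le> ennreal (exp c' * f q / L)" by (rule H_bound) simp
    finally show "emeasure Q (G n) \<le> ennreal (exp c' * f q / L)" .
  qed
  finally show ?thesis .
qed

section \<open>The scale function and the quenched diffusion\<close>

text \<open>A bounded nondecreasing primitive would converge to its supremum, making the integral of
  \<open>f\<close> over the half-line finite.\<close>

lemma primitive_unbounded:
  fixes F f :: "real \<Rightarrow> real"
  assumes F: "\<And>x. (F has_real_derivative f x) (at x)" and f: "\<And>x. 0 \<le> f x" "f \<in> borel_measurable borel"
    and inf: "(\<integral>\<^sup>+x\<in>{0..}. ennreal (f x) \<partial>lborel) = \<infinity>"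
  obtains x where "c < F x"
proof (rule ccontr)
  assume "\<not> thesis"
  then have le: "F x \<le> c" for x using that not_le by blast
  have mono: "F x \<le> F y" if "x \<le> y" for x y
    using DERIV_nonneg_imp_nondecreasing[OF that, of F] F f(1) by blast
  have bdd: "bdd_above (range F)" using le by (auto intro!: bdd_aboveI)
  have "(F \<longlongrightarrow> (SUP x. F x)) at_top"
  proof (rule increasing_tendsto)
    show "\<forall>\<^sub>F x in at_top. F x \<le> (SUP x. F x)" by (auto intro!: always_eventually cSUP_upper bdd)
    fix u assume "u < (SUP x. F x)"
    then obtain y where "u < F y" using less_cSUP_iff[OF _ bdd] by auto
    then show "\<forall>\<^sub>F x in at_top. u < F x"
      by (rule eventually_mono[OF eventually_ge_at_top[of y] less_le_trans[OF _ mono]])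
  qed
  then have "(\<integral>\<^sup>+x. ennreal (f x) * indicator {0..} x \<partial>lborel) = ennreal ((SUP x. F x) - F 0)"
    using F f by (intro nn_integral_FTC_atLeast) auto
  then show False using inf by simp
qed

lemma scale_fun_has_derivative:
  assumes "continuous_on UNIV a"
  shows "(scale_fun a has_real_derivative exp (- a x)) (at x)"
  unfolding scale_fun_def[abs_def] zero_ereal_def
  by (rule has_real_derivative_interval_integral) (intro continuous_intros assms)

lemma scale_fun_strict_mono:
  assumes "continuous_on UNIV a" "x < y"
  shows "scale_fun a x < scale_fun a y"
  by (rule DERIV_pos_imp_increasing[OF assms(2)])
     (use scale_fun_has_derivative[OF assms(1)] exp_gt_zero in blast)

text \<open>Divergence of the two integrals makes the scale function unbounded above and below, the
  left half being reduced to the right one by reflection; the intermediate value theorem then gives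
  surjectivity.\<close>

lemma bij_scale_fun:
  assumes a: "continuous_on UNIV a"
    and right: "(\<integral>\<^sup>+z\<in>{0..}. ennreal (exp (- a z)) \<partial>lborel) = \<infinity>"
    and left: "(\<integral>\<^sup>+z\<in>{..0}. ennreal (exp (- a z)) \<partial>lborel) = \<infinity>"
  shows "bij (scale_fun a)"
proof (rule bijI)
  show "inj (scale_fun a)"
    using scale_fun_strict_mono[OF a] by (rule linorder_injI[OF less_imp_neq])
  have [measurable]: "a \<in> borel_measurable borel" using a by (rule borel_measurable_continuous_onI)
  have cont: "continuous_on S (scale_fun a)" for S
    by (rule DERIV_continuous_on) (rule has_field_derivative_at_within[OF scale_fun_has_derivative[OF a]])
  show "surj (scale_fun a)"
    unfolding surj_def
  proof
    fix y
    obtain v where v: "y < scale_fun a v"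
      by (rule primitive_unbounded[where F = "scale_fun a" and f = "\<lambda>z. exp (- a z)" and c = y, OF scale_fun_has_derivative[OF a] _ _ right]) auto
    have "(\<integral>\<^sup>+z\<in>{0..}. ennreal (exp (- a (- z))) \<partial>lborel) = (\<integral>\<^sup>+z\<in>{..0}. ennreal (exp (- a z)) \<partial>lborel)"
      by (subst (2) nn_integral_real_affine[where c = "-1" and t = 0])
         (auto intro!: nn_integral_cong simp: indicator_def)
    with left have left': "(\<integral>\<^sup>+z\<in>{0..}. ennreal (exp (- a (- z))) \<partial>lborel) = \<infinity>" by simp
    have der: "((\<lambda>z. - scale_fun a (- z)) has_real_derivative exp (- a (- z))) (at z)" for z
      using DERIV_minus[OF DERIV_chain2[OF scale_fun_has_derivative[OF a, of "- z"] DERIV_minus[OF DERIV_ident]]]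
      by simp
    obtain u where "- y < - scale_fun a (- u)"
      by (rule primitive_unbounded[where F = "\<lambda>z. - scale_fun a (- z)" and f = "\<lambda>z. exp (- a (- z))" and c = "- y", OF der _ _ left']) auto
    then have u: "scale_fun a (- u) < y" by simp
    have "- u \<le> v"
      using u v scale_fun_strict_mono[OF a, of v "- u"] by linarith
    then obtain x where "scale_fun a x = y"
      using IVT'[of "scale_fun a" "- u" y v, OF less_imp_le[OF u] less_imp_le[OF v] _ cont] by blast
    then show "\<exists>x. y = scale_fun a x" by blast
  qed
qed

lemma inv_scale_fun_has_derivative:
  assumes a: "continuous_on UNIV a" and bij: "bij (scale_fun a)"
  shows "(inv (scale_fun a) has_real_derivative exp (a (inv (scale_fun a) y))) (at y)"
proof -
  let ?S = "scale_fun a" and ?T = "inv (scale_fun a)"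
  have ST: "?S (?T y) = y" for y using bij by (simp add: bij_is_surj surj_f_inv_f)
  have TS: "?T (?S x) = x" for x using bij by (simp add: bij_is_inj)
  have "isCont ?T (?S (?T y))"
    by (rule isCont_inverse_function2[where f = ?S and a = "?T y - 1" and b = "?T y + 1" and x = "?T y"])
       (use TS DERIV_isCont[OF scale_fun_has_derivative[OF a]] in simp_all)
  then have cont: "isCont ?T y" unfolding ST .
  have "(?T has_real_derivative inverse (exp (- a (?T y)))) (at y)"
    by (rule DERIV_inverse_function[where f = ?S and a = "y - 1" and b = "y + 1", OF scale_fun_has_derivative[OF a] _ _ _ _ cont])
       (use ST in simp_all)
  then show ?thesis by (simp add: exp_minus)
qed

text \<open>The lower bound \<open>v\<close> is assumed only while \<open>\<psi>\<close> is below
  \<open>r\<close>, because the coefficients are controlled only inside the intrinsic ball. If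
  \<open>\<psi>\<close> stayed below \<open>r\<close> up to distance \<open>r / v\<close>, its slope
  would bring it to \<open>r\<close> there.\<close>

lemma primitive_reaches_level:
  fixes \<psi> w :: "real \<Rightarrow> real"
  assumes \<psi>: "\<And>y. (\<psi> has_real_derivative w y) (at y)" and "\<psi> x = 0" "0 < v" "0 \<le> r"
    and lower: "\<And>y. x \<le> y \<Longrightarrow> 0 \<le> w y" "\<And>y. x \<le> y \<Longrightarrow> \<psi> y < r \<Longrightarrow> v \<le> w y"
  obtains y where "x \<le> y" "\<psi> y = r"
proof -
  define z where "z = x + r / v"
  have "x \<le> z" using \<open>0 < v\<close> \<open>0 \<le> r\<close> by (simp add: z_def)
  have cont: "continuous_on S \<psi>" for S
    by (rule DERIV_continuous_on) (rule has_field_derivative_at_within[OF \<psi>])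
  have "r \<le> \<psi> z"
  proof (rule ccontr)
    assume less: "\<not> r \<le> \<psi> z"
    have "\<psi> x - v * (x - x) \<le> \<psi> z - v * (z - x)"
    proof (rule DERIV_nonneg_imp_nondecreasing[OF \<open>x \<le> z\<close>, where f = "\<lambda>y. \<psi> y - v * (y - x)"])
      fix y assume y: "x \<le> y" "y \<le> z"
      have "\<psi> y \<le> \<psi> z"
        by (rule DERIV_nonneg_imp_nondecreasing[OF y(2)]) (use \<psi> lower(1) y(1) order_trans in metis)
      then have "v \<le> w y" using less y by (intro lower) auto
      moreover have "((\<lambda>y. \<psi> y - v * (y - x)) has_real_derivative w y - v) (at y)"
        by (auto intro!: derivative_eq_intros \<psi>)
      ultimately show "\<exists>d. ((\<lambda>y. \<psi> y - v * (y - x)) has_real_derivative d) (at y) \<and> 0 \<le> d"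
        by force
    qed
    then show False using less \<open>\<psi> x = 0\<close> \<open>0 < v\<close> by (simp add: z_def)
  qed
  then obtain y where "x \<le> y" "\<psi> y = r"
    using IVT'[of \<psi> x r z, OF _ _ _ cont] \<open>\<psi> x = 0\<close> \<open>0 \<le> r\<close> \<open>x \<le> z\<close> by auto
  then show ?thesis by (rule that)
qed

section \<open>The exit bound in a fixed environment\<close>

text \<open>The argument runs in the natural scale with \<open>\<kappa> = \<eta> V\<close>. The
  radius \<open>r' < r\<close> provides a closed interval inside the ball, where \<open>R\<close>
  controls the coefficients, and \<open>t' > t\<close> leaves room for the discretisation; both are
  removed later by a limit.\<close>

lemma (in brownian_motion) exit_event_bound:
  fixes \<rho> a :: "real \<Rightarrow> real"
  assumes a: "continuous_on UNIV a" and \<rho>: "continuous_on UNIV \<rho>" and bij: "bij (scale_fun a)"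
    and q: "q = scale_fun a x"
    and R: "\<And>y. y \<in> intr_ball \<rho> a x r \<Longrightarrow> \<bar>\<rho> y\<bar> + \<bar>a y\<bar> \<le> R"
    and r': "0 < r'" "r' < r" and t: "0 < t" "t < t'" and "0 < \<eta>"
  shows "emeasure Q {\<omega> \<in> space Q. exit_time (intr_ball \<rho> a x r) (diffusion \<rho> a (\<lambda>s. B s \<omega>)) \<le> ereal t}
    \<le> ennreal (exp (1 + R + \<eta> * t' - sqrt (2 * \<eta>) * r'))"
proof -
  let ?S = "scale_fun a" and ?T = "inv (scale_fun a)" and ?D = "intr_ball \<rho> a x r"
  have ST: "?S (?T y) = y" for y using bij by (simp add: bij_is_surj surj_f_inv_f)
  have TS: "?T (?S y) = y" for y using bij by (simp add: bij_is_inj)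
  have dT: "(?T has_real_derivative exp (a (?T y))) (at y)" for y
    by (rule inv_scale_fun_has_derivative[OF a bij])
  have cont_T: "continuous_on UNIV ?T"
    by (rule DERIV_continuous_on) (rule has_field_derivative_at_within[OF dT])
  have S_mono: "?S u \<le> ?S v \<longleftrightarrow> u \<le> v" for u v
    using scale_fun_strict_mono[OF a] by (metis linorder_not_le order_le_less)
  define w where "w z = sqrt (1/2 * exp (\<rho> z - a z))" for z
  \<comment> \<open>The signed intrinsic distance from \<open>x\<close>.\<close>
  define \<psi> where "\<psi> y = (LBINT z=ereal x..ereal y. w z)" for y
  have w_pos: "0 < w z" for z by (simp add: w_def)
  have d\<psi>: "(\<psi> has_real_derivative w y) (at y)" for y
    unfolding \<psi>_def[abs_def] w_def
    by (rule has_real_derivative_interval_integral) (intro continuous_intros \<rho> a)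
  have \<psi>_mono: "\<psi> u \<le> \<psi> v" if "u \<le> v" for u v
    using DERIV_nonneg_imp_nondecreasing[OF that, of \<psi>] d\<psi> less_imp_le[OF w_pos] by blast
  have \<psi>_x: "\<psi> x = 0" by (simp add: \<psi>_def)
  have D_iff: "y \<in> ?D \<longleftrightarrow> \<bar>\<psi> y\<bar> < r" for y
    by (simp add: intr_ball_def intr_dist_def \<psi>_def w_def)
  have w_lower: "sqrt (exp (- R) / 2) \<le> w y" if "y \<in> ?D" for y
    using R[OF that] by (auto simp: w_def)
  obtain \<beta> where \<beta>: "x \<le> \<beta>" "\<psi> \<beta> = r'"
  proof (rule primitive_reaches_level[OF d\<psi> \<psi>_x, of "sqrt (exp (- R) / 2)" r'])
    fix y assume "x \<le> y" "\<psi> y < r'"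
    then show "sqrt (exp (- R) / 2) \<le> w y"
      using r' \<psi>_mono[of x y] \<psi>_x by (intro w_lower) (auto simp: D_iff)
  qed (use r' less_imp_le[OF w_pos] in auto)
  obtain \<alpha> where \<alpha>: "\<alpha> \<le> x" "\<psi> \<alpha> = - r'"
  proof -
    have d: "((\<lambda>y. - \<psi> (- y)) has_real_derivative w (- y)) (at y)" for y
      using DERIV_minus[OF DERIV_chain2[OF d\<psi>[of "- y"] DERIV_minus[OF DERIV_ident]]] by simp
    obtain y where "- x \<le> y" "- \<psi> (- y) = r'"
    proof (rule primitive_reaches_level[OF d, of "- x" "sqrt (exp (- R) / 2)" r'])
      fix y assume "- x \<le> y" "- \<psi> (- y) < r'"
      then show "sqrt (exp (- R) / 2) \<le> w (- y)"
        using r' \<psi>_mono[of "- y" x] \<psi>_x by (intro w_lower) (auto simp: D_iff)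
    qed (use r' less_imp_le[OF w_pos] \<psi>_x in auto)
    then show ?thesis by (intro that[of "- y"]) auto
  qed
  have \<alpha>\<beta>_D: "y \<in> ?D" if "y \<in> {\<alpha>..\<beta>}" for y
    using that \<psi>_mono[of \<alpha> y] \<psi>_mono[of y \<beta>] \<alpha> \<beta> r' by (auto simp: D_iff)
  define \<kappa> where "\<kappa> y = \<eta> * exp (\<rho> (?T y) + a (?T y))" for y
  define l where "l = sqrt \<eta> * exp (- R / 2)"
  define u where "u = sqrt \<eta> * exp (R / 2)"
  \<comment> \<open>The primitive of \<open>sqrt (\<kappa> y)\<close> vanishing at \<open>q\<close>:
    under the change of variables \<open>z = ?T y\<close> the factor \<open>exp (a z)\<close> turns
    \<open>w z\<close> into a multiple of \<open>sqrt (\<kappa> y)\<close>.\<close>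
  define \<Psi> where "\<Psi> y = sqrt (2 * \<eta>) * \<psi> (?T y)" for y
  have lu_sq: "l\<^sup>2 = \<eta> * exp (- R)" "u\<^sup>2 = \<eta> * exp R"
    using \<open>0 < \<eta>\<close> by (simp_all add: l_def u_def power_mult_distrib flip: exp_double)
  have lu: "0 < l" "0 < u" using \<open>0 < \<eta>\<close> by (auto simp: l_def u_def)
  have \<kappa>_cont: "continuous_on UNIV \<kappa>"
    unfolding \<kappa>_def
    by (intro continuous_intros continuous_on_compose2[OF \<rho> cont_T] continuous_on_compose2[OF a cont_T]) auto
  have \<kappa>_pos: "0 < \<kappa> y" for y using \<open>0 < \<eta>\<close> by (simp add: \<kappa>_def)
  have T_in: "?T y \<in> {\<alpha>..\<beta>} \<longleftrightarrow> y \<in> {?S \<alpha>..?S \<beta>}" for y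
    using S_mono[of \<alpha> "?T y"] S_mono[of "?T y" \<beta>] by (simp add: ST)
  have \<kappa>_bounds: "l\<^sup>2 \<le> \<kappa> y \<and> \<kappa> y \<le> u\<^sup>2" if "y \<in> {?S \<alpha>..?S \<beta>}" for y
  proof -
    have "\<bar>\<rho> (?T y)\<bar> + \<bar>a (?T y)\<bar> \<le> R" using that T_in by (intro R \<alpha>\<beta>_D) blast
    then show ?thesis
      using \<open>0 < \<eta>\<close> unfolding lu_sq \<kappa>_def by (auto intro!: mult_left_mono)
  qed
  have d\<Psi>: "(\<Psi> has_real_derivative sqrt (\<kappa> y)) (at y)" for y
  proof -
    have "sqrt (\<kappa> y) = sqrt (2 * \<eta>) * (w (?T y) * exp (a (?T y)))"
    proof -
      have "exp (a (?T y)) = sqrt ((exp (a (?T y)))\<^sup>2)" by simp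
      then have "sqrt (2 * \<eta>) * (w (?T y) * exp (a (?T y)))
          = sqrt (2 * \<eta> * (1/2 * exp (\<rho> (?T y) - a (?T y)) * (exp (a (?T y)))\<^sup>2))"
        unfolding w_def real_sqrt_mult by simp
      also have "2 * \<eta> * (1/2 * exp (\<rho> (?T y) - a (?T y)) * (exp (a (?T y)))\<^sup>2) = \<kappa> y"
        by (simp add: \<kappa>_def power2_eq_square flip: exp_add)
      finally show ?thesis by simp
    qed
    then show ?thesis
      unfolding \<Psi>_def using DERIV_cmult[OF DERIV_chain2[OF d\<psi> dT]] by metis
  qed
  have Sx: "?S \<alpha> \<le> q" "q \<le> ?S \<beta>" using \<alpha> \<beta> by (auto simp: q S_mono)
  obtain f g where f: "\<And>y. (f has_real_derivative g y) (at y)"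
    and g: "\<And>y. (g has_real_derivative \<kappa> (clip (?S \<alpha>) (?S \<beta>) y) * f (clip (?S \<alpha>) (?S \<beta>) y)) (at y)"
    and init: "f q = 1" "g q = 0" and f_ge_1: "\<And>y. 1 \<le> f y"
    by (rule clipped_linear_ode[OF \<kappa>_cont _ Sx lu(2)]) (use \<kappa>_bounds less_imp_le[OF \<kappa>_pos] in auto)
  have g': "(g has_real_derivative \<kappa> y * f y) (at y)" if "y \<in> {?S \<alpha>..?S \<beta>}" for y
    using g[of y] that by (simp add: min_absorb2 max_absorb2)
  define L where "L = exp (sqrt (2 * \<eta>) * r' - R - 1)"
  have lu_quot: "l / u = exp (- R)"
    using \<open>0 < \<eta>\<close> by (simp add: l_def u_def flip: exp_diff)
  have f_\<beta>: "L \<le> f (?S \<beta>)"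
  proof -
    have "l / u * exp (\<Psi> (?S \<beta>) - 1) \<le> f (?S \<beta>)"
      by (rule linear_ode_growth[OF f g' d\<Psi> \<kappa>_bounds f_ge_1 init(2) _ Sx(2) lu])
         (use Sx in \<open>auto simp: \<Psi>_def q TS \<psi>_x\<close>)
    then show ?thesis by (simp add: lu_quot \<Psi>_def TS \<beta> L_def algebra_simps flip: exp_add)
  qed
  \<comment> \<open>The left end point follows from the same growth lemma after the reflection of
    \<open>y\<close> to \<open>- y\<close>.\<close>
  have f_\<alpha>: "L \<le> f (?S \<alpha>)"
  proof -
    have reflect: "((\<lambda>y. h (- y)) has_real_derivative - d) (at y)"
      if "(h has_real_derivative d) (at (- y))" for h :: "real \<Rightarrow> real" and d y
      using DERIV_chain2[OF that DERIV_minus[OF DERIV_ident]] by simp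
    have "l / u * exp (- \<Psi> (- (- ?S \<alpha>)) - 1) \<le> f (- (- ?S \<alpha>))"
    proof (rule linear_ode_growth[where x = "- q" and q = "- ?S \<alpha>" and f = "\<lambda>y. f (- y)"
          and g = "\<lambda>y. - g (- y)" and k = "\<lambda>y. \<kappa> (- y)" and \<psi> = "\<lambda>y. - \<Psi> (- y)"])
      fix y assume "y \<in> {- q..- ?S \<alpha>}"
      then have y: "- y \<in> {?S \<alpha>..?S \<beta>}" using Sx by auto
      show "((\<lambda>y. f (- y)) has_real_derivative - g (- y)) (at y)" by (rule reflect[OF f])
      show "((\<lambda>y. - g (- y)) has_real_derivative \<kappa> (- y) * f (- y)) (at y)"
        using DERIV_minus[OF reflect[OF g'[OF y]]] by simp
      show "((\<lambda>y. - \<Psi> (- y)) has_real_derivative sqrt (\<kappa> (- y))) (at y)"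
        using DERIV_minus[OF reflect[OF d\<Psi>]] by simp
      show "l\<^sup>2 \<le> \<kappa> (- y) \<and> \<kappa> (- y) \<le> u\<^sup>2" by (rule \<kappa>_bounds[OF y])
    qed (use Sx lu init f_ge_1 in \<open>auto simp: \<Psi>_def q TS \<psi>_x\<close>)
    then show ?thesis by (simp add: lu_quot \<Psi>_def TS \<alpha> L_def algebra_simps flip: exp_add)
  qed
  \<comment> \<open>\<open>f\<close> is convex with its minimum at \<open>q\<close>, so beyond an
    end point it is at least its value there.\<close>
  have f_exit: "L \<le> f y" if "y \<notin> {?S \<alpha>..?S \<beta>}" for y
  proof -
    have mono: "f u \<le> f v" if "q \<le> u \<and> u \<le> v \<or> v \<le> u \<and> u \<le> q" for u v
      by (rule second_deriv_nonneg_mono[OF f g _ init(2) that])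
         (intro mult_nonneg_nonneg less_imp_le[OF \<kappa>_pos] order_trans[OF zero_le_one f_ge_1])
    consider "?S \<beta> \<le> y" | "y \<le> ?S \<alpha>" using \<open>y \<notin> {?S \<alpha>..?S \<beta>}\<close> by (auto simp: not_le)
    then show ?thesis
      using mono[of "?S \<beta>" y] mono[of "?S \<alpha>" y] f_\<alpha> f_\<beta> Sx by cases auto
  qed
  \<comment> \<open>The midpoint serves twice: an infimum at most \<open>t\<close> yields a genuine
    exit before \<open>?t\<close>, and \<open>?t < t'\<close> provides the gap between the clock
    levels.\<close>
  let ?t = "(t + t') / 2"
  have "emeasure Q {\<omega> \<in> space Q. exit_time ?D (diffusion \<rho> a (\<lambda>s. B s \<omega>)) \<le> ereal t}
    \<le> ennreal (exp (\<eta> * t') * f q / L)"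
  proof (rule exit_before_clock_bound[OF \<kappa>_cont _ _ _ f g f_ge_1 f_exit, where c = "\<eta> * ?t" and l = "l\<^sup>2"])
    fix \<omega> assume "\<omega> \<in> {\<omega> \<in> space Q. exit_time ?D (diffusion \<rho> a (\<lambda>s. B s \<omega>)) \<le> ereal t}"
    then have \<omega>: "\<omega> \<in> space Q" and le: "exit_time ?D (diffusion \<rho> a (\<lambda>s. B s \<omega>)) \<le> ereal t" by auto
    let ?b = "\<lambda>s. B s \<omega>"
    have "exit_time ?D (diffusion \<rho> a ?b) < ereal ?t"
      using le t by (auto intro: le_less_trans)
    then obtain s where s: "0 \<le> s" "s < ?t" "diffusion \<rho> a ?b s \<notin> ?D"
      unfolding exit_time_def Inf_less_iff by auto
    define T where "T = clock_inv \<rho> a ?b s"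
    \<comment> \<open>Outside the range of the clock the default 0 puts the diffusion at its
      starting point \<open>x\<close>, which belongs to the ball; so no exit can be observed
      there.\<close>
    have "s \<in> clock \<rho> a ?b ` {0..}"
    proof (rule ccontr)
      assume "s \<notin> clock \<rho> a ?b ` {0..}"
      then have "diffusion \<rho> a ?b s = x"
        using start_B[OF \<omega>] by (simp add: diffusion_def clock_inv_def q TS)
      then show False using s(3) \<psi>_x r' by (simp add: D_iff)
    qed
    then have T: "0 \<le> T" "clock \<rho> a ?b T = s"
      using inv_into_into[of s "clock \<rho> a ?b" "{0..}"] f_inv_into_f[of s "clock \<rho> a ?b" "{0..}"]
      by (auto simp: T_def clock_inv_def)
    have "?T (B T \<omega>) \<notin> {\<alpha>..\<beta>}"
      using s(3) \<alpha>\<beta>_D by (auto simp: diffusion_def T_def)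
    then have exit: "B T \<omega> \<notin> {?S \<alpha>..?S \<beta>}" using T_in by blast
    have inv_sq: "inverse ((diff_coeff \<rho> a y)\<^sup>2) = exp (\<rho> (?T y) + a (?T y)) / 2" for y
      by (simp add: diff_coeff_def power_mult_distrib exp_minus field_simps flip: exp_double exp_add)
    have "(LBINT s=ereal 0..ereal T. \<kappa> (B (max 0 s) \<omega>) / 2)
        = (LBINT s=ereal 0..ereal T. \<eta> * inverse ((diff_coeff \<rho> a (B s \<omega>))\<^sup>2))"
      using T(1) by (intro interval_integral_cong) (auto simp: einterval_iff inv_sq \<kappa>_def max_def)
    also have "\<dots> = \<eta> * s"
      using T(2) by (simp add: clock_def zero_ereal_def)
    also have "\<dots> < \<eta> * ?t" using s(2) \<open>0 < \<eta>\<close> by simp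
    finally show "\<omega> \<in> space Q \<and> (\<exists>T\<ge>0. B T \<omega> \<notin> {?S \<alpha>..?S \<beta>} \<and>
        (LBINT s=ereal 0..ereal T. \<kappa> (B (max 0 s) \<omega>) / 2) < \<eta> * ?t)"
      using \<omega> T(1) exit by blast
  qed (use \<kappa>_bounds less_imp_le[OF \<kappa>_pos] lu Sx t \<open>0 < \<eta>\<close> in \<open>auto simp: L_def\<close>)
  also have "exp (\<eta> * t') * f q / L = exp (1 + R + \<eta> * t' - sqrt (2 * \<eta>) * r')"
    by (simp add: init L_def algebra_simps flip: exp_diff)
  finally show ?thesis .
qed

text \<open>The auxiliary radius and time are \<open>r * s\<close> and \<open>t / s\<close>, and
  \<open>s\<close> tends to 1 from below. The left-hand side does not depend on \<open>s\<close>, so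
  the bound passes to the limit.\<close>

lemma (in brownian_motion) quenched_exit_bound:
  fixes \<rho> a :: "real \<Rightarrow> real"
  assumes a: "continuous_on UNIV a" and \<rho>: "continuous_on UNIV \<rho>" and bij: "bij (scale_fun a)"
    and q: "q = scale_fun a x"
    and R: "\<And>y. y \<in> intr_ball \<rho> a x r \<Longrightarrow> \<bar>\<rho> y\<bar> + \<bar>a y\<bar> \<le> R"
    and "0 < r" "0 < t"
  shows "emeasure Q {\<omega> \<in> space Q. exit_time (intr_ball \<rho> a x r) (diffusion \<rho> a (\<lambda>s. B s \<omega>)) \<le> ereal t}
    \<le> ennreal (exp (1 + R) * exp (- (r\<^sup>2 / (2 * t))))"
proof -
  let ?P = "emeasure Q {\<omega> \<in> space Q. exit_time (intr_ball \<rho> a x r) (diffusion \<rho> a (\<lambda>s. B s \<omega>)) \<le> ereal t}"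
  \<comment> \<open>the minimiser of \<open>\<eta> t - sqrt (2 \<eta>) r\<close>\<close>
  define \<eta> where "\<eta> = r\<^sup>2 / (2 * t\<^sup>2)"
  define e where "e s = 1 + R + \<eta> * (t / s) - sqrt (2 * \<eta>) * (r * s)" for s
  have "0 < \<eta>" using \<open>0 < r\<close> \<open>0 < t\<close> by (simp add: \<eta>_def)
  have sqrt_\<eta>: "sqrt (2 * \<eta>) = r / t"
    using \<open>0 < r\<close> \<open>0 < t\<close> by (simp add: \<eta>_def real_sqrt_divide)
  have "?P \<le> ennreal (exp (e s))" if "0 < s" "s < 1" for s
    unfolding e_def
  proof (rule exit_event_bound[OF a \<rho> bij q R])
    show "t < t / s" using that \<open>0 < t\<close> by (simp add: field_simps)
    show "r * s < r" "0 < r * s" using that \<open>0 < r\<close> by simp_all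
  qed (use \<open>0 < t\<close> \<open>0 < \<eta>\<close> in auto)
  then have ev: "\<forall>\<^sub>F s in at_left 1. ?P \<le> ennreal (exp (e s))"
    by (intro eventually_mono[OF eventually_at_left_real[of 0 1]]) auto
  have "((\<lambda>s. ennreal (exp (e s))) \<longlongrightarrow> ennreal (exp (e 1))) (at_left 1)"
    unfolding e_def by (intro tendsto_intros) auto
  then have "?P \<le> ennreal (exp (e 1))"
    by (rule tendsto_lowerbound[OF _ ev]) simp
  also have "e 1 = (1 + R) + - (r\<^sup>2 / (2 * t))"
    unfolding e_def sqrt_\<eta> using \<open>0 < t\<close> by (simp add: \<eta>_def power2_eq_square field_simps)
  finally show ?thesis unfolding exp_add .
qed

section \<open>The exponent \<open>a_coeff\<close> and the bound in its stated form\<close>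

lemma a_coeff_le_half: "0 < \<theta> \<Longrightarrow> \<theta> < 1 \<Longrightarrow> a_coeff \<theta> \<le> 1 / 2"
proof -
  assume \<theta>: "0 < \<theta>" "\<theta> < 1"
  then have "(1 - \<theta>)\<^sup>2 \<le> 1" by (simp add: power_le_one)
  then show ?thesis using \<theta> unfolding a_coeff_def by (simp add: field_simps)
qed

lemma antimono_a_coeff: "antimono_on {0<..<1} a_coeff"
proof (rule monotone_onI)
  fix s t :: real assume st: "s \<in> {0<..<1}" "t \<in> {0<..<1}" "s \<le> t"
  then have "(1 - t)\<^sup>2 \<le> (1 - s)\<^sup>2" by (intro power_mono) auto
  then show "a_coeff s \<ge> a_coeff t"
    unfolding a_coeff_def using st by (intro frac_le) auto
qed

lemma a_coeff_tendsto: "(a_coeff \<longlongrightarrow> 1 / 2) (at_right 0)"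
proof -
  have "((\<lambda>\<theta>. (1 - \<theta>)\<^sup>2 / (2 * (1 + \<theta>))) \<longlongrightarrow> (1 - 0)\<^sup>2 / (2 * (1 + 0))) (at_right (0 :: real))"
    by (intro tendsto_intros) auto
  then show ?thesis by (simp add: a_coeff_def[abs_def])
qed

lemma coeff_bound_finite:
  assumes "coeff_bound \<rho> a D \<noteq> \<infinity>" "y \<in> D"
  shows "\<bar>\<rho> y\<bar> + \<bar>a y\<bar> \<le> enn2real (coeff_bound \<rho> a D)"
proof -
  have "ennreal (\<bar>\<rho> y\<bar> + \<bar>a y\<bar>) \<le> coeff_bound \<rho> a D"
    unfolding coeff_bound_def using \<open>y \<in> D\<close> by (auto intro!: add_mono SUP_upper)
  also have "\<dots> = ennreal (enn2real (coeff_bound \<rho> a D))"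
    using assms(1) by (simp add: top.not_eq_extremum)
  finally show ?thesis by (subst (asm) ennreal_le_iff) auto
qed

text \<open>If \<open>coeff_bound\<close> is infinite, the right-hand side is infinite because its
  other factors are positive. Otherwise \<open>exp 1 \<le> 3\<close> and
  \<open>1 \<le> t powr (- 1)\<close> absorb the constant factor, and
  \<open>a_coeff \<theta> \<le> 1 / 2\<close> weakens the exponent.\<close>

lemma (in brownian_motion) exit_bound_coeff:
  fixes \<rho> a :: "real \<Rightarrow> real"
  assumes a: "continuous_on UNIV a" and \<rho>: "continuous_on UNIV \<rho>" and bij: "bij (scale_fun a)"
    and q: "q = scale_fun a x" and t: "0 < t" "t < 1" and "0 < r" and \<theta>: "0 < \<theta>" "\<theta> < 1"
  shows "emeasure Q {\<omega> \<in> space Q. exit_time (intr_ball \<rho> a x r) (diffusion \<rho> a (\<lambda>s. B s \<omega>)) \<le> ereal t}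
    \<le> ennreal (3 * t powr (- 1)) * exp_ennreal (ennreal 3 * coeff_bound \<rho> a (intr_ball \<rho> a x r))
      * ennreal (exp (- a_coeff \<theta> * (r\<^sup>2 / t)))"
proof (cases "coeff_bound \<rho> a (intr_ball \<rho> a x r) = \<infinity>")
  case True
  then show ?thesis
    using t by (simp add: exp_ennreal_def ennreal_mult_top ennreal_top_mult)
next
  case False
  define R where "R = enn2real (coeff_bound \<rho> a (intr_ball \<rho> a x r))"
  have "0 \<le> R" by (simp add: R_def)
  have R_eq: "coeff_bound \<rho> a (intr_ball \<rho> a x r) = ennreal R"
    using False by (simp add: R_def top.not_eq_extremum)
  have "emeasure Q {\<omega> \<in> space Q. exit_time (intr_ball \<rho> a x r) (diffusion \<rho> a (\<lambda>s. B s \<omega>)) \<le> ereal t}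
      \<le> ennreal (exp (1 + R) * exp (- (r\<^sup>2 / (2 * t))))"
    unfolding R_def
    by (rule quenched_exit_bound[OF a \<rho> bij q coeff_bound_finite[OF False] \<open>0 < r\<close> t(1)])
  also have "\<dots> \<le> ennreal (3 * t powr (- 1) * exp (3 * R) * exp (- a_coeff \<theta> * (r\<^sup>2 / t)))"
  proof (intro ennreal_leI mult_mono)
    have "1 \<le> t powr (- 1)" using t by (simp add: powr_minus_divide)
    then have "exp 1 \<le> 3 * t powr (- 1)" using exp_le by linarith
    then show "exp (1 + R) \<le> 3 * t powr (- 1) * exp (3 * R)"
      unfolding exp_add using \<open>0 \<le> R\<close> by (intro mult_mono) auto
    have "a_coeff \<theta> * (r\<^sup>2 / t) \<le> 1 / 2 * (r\<^sup>2 / t)"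
      using a_coeff_le_half[OF \<theta>] t by (intro mult_right_mono) auto
    then show "exp (- (r\<^sup>2 / (2 * t))) \<le> exp (- a_coeff \<theta> * (r\<^sup>2 / t))" by simp
  qed auto
  also have "\<dots> = ennreal (3 * t powr (- 1)) * exp_ennreal (ennreal 3 * coeff_bound \<rho> a (intr_ball \<rho> a x r))
      * ennreal (exp (- a_coeff \<theta> * (r\<^sup>2 / t)))"
  proof -
    have "exp_ennreal (ennreal 3 * ennreal R) = ennreal (exp (3 * R))"
      using \<open>0 \<le> R\<close> by (simp add: exp_ennreal_def ennreal_mult[symmetric] del: ennreal_numeral)
    moreover have "ennreal (u * v * w) = ennreal u * ennreal v * ennreal w"
      if "0 \<le> u" "0 \<le> v" "0 \<le> w" for u v w
      using that by (simp add: ennreal_mult)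
    ultimately show ?thesis unfolding R_eq by (simp only: exp_ge_zero powr_ge_zero mult_nonneg_nonneg zero_le_numeral)
  qed
  finally show ?thesis .
qed

theorem theorem2p2:
  shows "(\<forall>\<theta>\<in>{0<..<1}. \<exists>C>0. \<exists>N>0.
      \<forall>(M :: 'w measure) \<rho> a. random_environment M \<rho> a \<longrightarrow>
        (AE W in M. \<forall>t r x. 0 < t \<and> t < 1 \<and> 0 < r \<longrightarrow>
          (\<forall>(Q :: 'b measure) B. brownian_motion Q B (scale_fun (\<lambda>z. a z W) x) \<longrightarrow>
            emeasure Q {\<omega> \<in> space Q.
                exit_time (intr_ball (\<lambda>z. \<rho> z W) (\<lambda>z. a z W) x r)
                  (diffusion (\<lambda>z. \<rho> z W) (\<lambda>z. a z W) (\<lambda>s. B s \<omega>)) \<le> ereal t}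
            \<le> ennreal (C * t powr (- N)) *
               exp_ennreal (ennreal C *
                 coeff_bound (\<lambda>z. \<rho> z W) (\<lambda>z. a z W)
                   (intr_ball (\<lambda>z. \<rho> z W) (\<lambda>z. a z W) x r)) *
               ennreal (exp (- a_coeff \<theta> * (r\<^sup>2 / t)))))) \<and>
    antimono_on {0<..<1} a_coeff \<and> (a_coeff \<longlongrightarrow> 1/2) (at_right 0)"
proof (intro conjI antimono_a_coeff a_coeff_tendsto ballI)
  fix \<theta> :: real assume \<theta>: "\<theta> \<in> {0<..<1}"
  show "\<exists>C>0. \<exists>N>0.
      \<forall>(M :: 'w measure) \<rho> a. random_environment M \<rho> a \<longrightarrow>
        (AE W in M. \<forall>t r x. 0 < t \<and> t < 1 \<and> 0 < r \<longrightarrow>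
          (\<forall>(Q :: 'b measure) B. brownian_motion Q B (scale_fun (\<lambda>z. a z W) x) \<longrightarrow>
            emeasure Q {\<omega> \<in> space Q.
                exit_time (intr_ball (\<lambda>z. \<rho> z W) (\<lambda>z. a z W) x r)
                  (diffusion (\<lambda>z. \<rho> z W) (\<lambda>z. a z W) (\<lambda>s. B s \<omega>)) \<le> ereal t}
            \<le> ennreal (C * t powr (- N)) *
               exp_ennreal (ennreal C *
                 coeff_bound (\<lambda>z. \<rho> z W) (\<lambda>z. a z W)
                   (intr_ball (\<lambda>z. \<rho> z W) (\<lambda>z. a z W) x r)) *
               ennreal (exp (- a_coeff \<theta> * (r\<^sup>2 / t)))))"
  \<comment> \<open>The constants \<open>C = 3\<close> and \<open>N = 1\<close> serve every
    \<open>\<theta>\<close> and every environment.\<close>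
  proof (rule exI[of _ 3], rule conjI, simp, rule exI[of _ 1], rule conjI, simp, intro allI impI)
    fix M :: "'w measure" and \<rho> a :: "real \<Rightarrow> 'w \<Rightarrow> real"
    assume "random_environment M \<rho> a"
    then interpret random_environment M \<rho> a .
    \<comment> \<open>The exceptional null set comes only from continuity and the divergent scale
      integrals, so it is independent of \<open>t\<close>, \<open>r\<close>, \<open>x\<close> and
      the Brownian motion.\<close>
    show "AE W in M. \<forall>t r x. 0 < t \<and> t < 1 \<and> 0 < r \<longrightarrow>
          (\<forall>(Q :: 'b measure) B. brownian_motion Q B (scale_fun (\<lambda>z. a z W) x) \<longrightarrow>
            emeasure Q {\<omega> \<in> space Q.
                exit_time (intr_ball (\<lambda>z. \<rho> z W) (\<lambda>z. a z W) x r)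
                  (diffusion (\<lambda>z. \<rho> z W) (\<lambda>z. a z W) (\<lambda>s. B s \<omega>)) \<le> ereal t}
            \<le> ennreal (3 * t powr (- 1)) *
               exp_ennreal (ennreal 3 *
                 coeff_bound (\<lambda>z. \<rho> z W) (\<lambda>z. a z W)
                   (intr_ball (\<lambda>z. \<rho> z W) (\<lambda>z. a z W) x r)) *
               ennreal (exp (- a_coeff \<theta> * (r\<^sup>2 / t))))"
      using continuous_env scale_infinite
    proof eventually_elim
      case (elim W)
      then have "bij (scale_fun (\<lambda>z. a z W))" by (intro bij_scale_fun) auto
      then show ?case
        using elim \<theta> by (intro allI impI brownian_motion.exit_bound_coeff) auto
    qed
  qed
qed

end
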